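(* Let $V$ be an irreducible $\triangle_q$-module whose dimension is less than $d'$. Then there exist $(a,b,c)\in(\mathbb F^\times)^3$ and an integer $n$ with $0\le n\le d'-2$ such that the $\triangle_q$-module $V_n(a,b,c)$ is isomorphic to $V$.
   Context: $\mathbb F$ is an algebraically closed field and $q\in\mathbb F^\times$ is a root of unity of order $d$ with $d\notin\{1,2,4\}$. Put $d'=d$ if $d$ is odd and $d'=d/2$ if $d$ is even (so $d'$ is the order of $q^2$ and $d'\ge 3$). The universal Askey–Wilson algebra $\triangle_q$ is the unital associative $\mathbb F$-algebra with generators $A,B,C$ subject to the relations that each of $A+\frac{qBC-q^{-1}CB}{q^2-q^{-2}}$, $B+\frac{qCA-q^{-1}AC}{q^2-q^{-2}}$, $C+\frac{qAB-q^{-1}BA}{q^2-q^{-2}}$ is central; let $\alpha,\beta,\gamma$ be these three central elements multiplied by $q+q^{-1}$, respectively. For $(a,b,c,\lambda)\in(\mathbb F^\times)^4$ and $i\in\mathbb N$ set $\theta_i=a\lambda^{-1}q^{2i}+a^{-1}\lambda q^{-2i}$, $\theta_i^*=b\lambda^{-1}q^{2i}+b^{-1}\lambda q^{-2i}$, and $\varphi_i=a^{-1}b^{-1}\lambda q(q^i-q^{-i})(\lambda^{-1}q^{i-1}-\lambda q^{1-i})(q^{-i}-abc\lambda^{-1}q^{i-1})(q^{-i}-abc^{-1}\lambda^{-1}q^{i-1})$ (note $\varphi_0=0$). The Verma module $M_\lambda(a,b,c)$ is the (existing) $\triangle_q$-module with basis $\{m_i\}_{i\in\mathbb N}$ such that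 $(A-\theta_i)m_i=m_{i+1}$ and $(B-\theta_i^* )m_i=\varphi_i m_{i-1}$ for all $i\in\mathbb N$ (with $m_{-1}$ arbitrary), and on which $\alpha,\beta,\gamma$ act as the scalars $(b+b^{-1})(c+c^{-1})+(a+a^{-1})(\lambda q+\lambda^{-1}q^{-1})$, $(c+c^{-1})(a+a^{-1})+(b+b^{-1})(\lambda q+\lambda^{-1}q^{-1})$, $(a+a^{-1})(b+b^{-1})+(c+c^{-1})(\lambda q+\lambda^{-1}q^{-1})$ respectively. For $(a,b,c)\in(\mathbb F^\times)^3$ and $n\in\mathbb N$, with $\lambda=q^n$, the span $N$ of $\{m_i\}_{i\ge n+1}$ is a $\triangle_q$-submodule of $M_{q^n}(a,b,c)$, and $V_n(a,b,c):=M_{q^n}(a,b,c)/N$ is an $(n+1)$-dimensional $\triangle_q$-module. *)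

theory Defs
  imports "HOL-Computational_Algebra.Polynomial"
begin

text \<open>A module over the universal Askey--Wilson algebra over the field 'a is
  a vector space (type 'v with scalar multiplication scale) together with the
  linear operators by which the generators A, B, C act, such that the three
  elements A + (qBC - q^{-1}CB)/(q^2-q^{-2}) etc. (central in the algebra)
  act by operators commuting with the actions of A, B and C (equivalently with
  the whole algebra, as A, B, C generate it).\<close>

definition aw_cen :: "'a::field \<Rightarrow> ('a \<Rightarrow> 'v::ab_group_add \<Rightarrow> 'v)
    \<Rightarrow> ('v \<Rightarrow> 'v) \<Rightarrow> ('v \<Rightarrow> 'v) \<Rightarrow> ('v \<Rightarrow> 'v) \<Rightarrow> ('v \<Rightarrow> 'v)" where
  "aw_cen q scale X Y Z = (\<lambda>v. X v + scale (inverse (q^2 - inverse q ^ 2))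
       (scale q (Y (Z v)) - scale (inverse q) (Z (Y v))))"

definition aw_module :: "'a::field \<Rightarrow> ('a \<Rightarrow> 'v::ab_group_add \<Rightarrow> 'v)
    \<Rightarrow> ('v \<Rightarrow> 'v) \<Rightarrow> ('v \<Rightarrow> 'v) \<Rightarrow> ('v \<Rightarrow> 'v) \<Rightarrow> bool" where
  "aw_module q scale A B C \<longleftrightarrow>
     vector_space scale \<and>
     Vector_Spaces.linear scale scale A \<and> Vector_Spaces.linear scale scale B \<and> Vector_Spaces.linear scale scale C \<and>
     (\<forall>Z \<in> {aw_cen q scale A B C, aw_cen q scale B C A, aw_cen q scale C A B}.
        \<forall>X \<in> {A, B, C}. Z \<circ> X = X \<circ> Z)"

definition aw_irreducible :: "'a::field \<Rightarrow> ('a \<Rightarrow> 'v::ab_group_add \<Rightarrow> 'v)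
    \<Rightarrow> ('v \<Rightarrow> 'v) \<Rightarrow> ('v \<Rightarrow> 'v) \<Rightarrow> ('v \<Rightarrow> 'v) \<Rightarrow> bool" where
  "aw_irreducible q scale A B C \<longleftrightarrow>
     aw_module q scale A B C \<and> (UNIV :: 'v set) \<noteq> {0} \<and>
     (\<forall>W. module.subspace scale W \<and> A ` W \<subseteq> W \<and> B ` W \<subseteq> W \<and> C ` W \<subseteq> W
          \<longrightarrow> W = {0} \<or> W = UNIV)"

definition fin_dim :: "('a::field \<Rightarrow> 'v::ab_group_add \<Rightarrow> 'v) \<Rightarrow> bool" where
  "fin_dim scale \<longleftrightarrow> (\<exists>S. finite S \<and> module.span scale S = UNIV)"

text \<open>Parameters of the Verma module M_lambda(a,b,c).\<close>

definition vth :: "'a::field \<Rightarrow> 'a \<Rightarrow> 'a \<Rightarrow> nat \<Rightarrow> 'a" where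
  "vth q a lam i = a * inverse lam * q powi (2 * int i) + inverse a * lam * q powi (- 2 * int i)"

definition vphi :: "'a::field \<Rightarrow> 'a \<Rightarrow> 'a \<Rightarrow> 'a \<Rightarrow> 'a \<Rightarrow> nat \<Rightarrow> 'a" where
  "vphi q a b c lam i =
     inverse a * inverse b * lam * q * (q powi int i - q powi (- int i))
     * (inverse lam * q powi (int i - 1) - lam * q powi (1 - int i))
     * (q powi (- int i) - a * b * c * inverse lam * q powi (int i - 1))
     * (q powi (- int i) - a * b * inverse c * inverse lam * q powi (int i - 1))"

text \<open>Scalar by which gamma acts on M_lambda(a,b,c).\<close>

definition vgamma :: "'a::field \<Rightarrow> 'a \<Rightarrow> 'a \<Rightarrow> 'a \<Rightarrow> 'a \<Rightarrow> 'a" where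
  "vgamma q a b c lam = (a + inverse a) * (b + inverse b)
     + (c + inverse c) * (lam * q + inverse lam * inverse q)"

text \<open>V_n(a,b,c) = M_{q^n}(a,b,c)/span{m_i : i > n} is realised on the space
  Vn_space n of coefficient vectors f :: nat \<Rightarrow> 'a with f i = 0 for i > n;
  f stands for the class of sum_{i \<le> n} f i m_i.  A and B act as on the Verma
  module (with m_{n+1} = 0 in the quotient).  Since
  gamma/(q+q^{-1}) = C + (qAB - q^{-1}BA)/(q^2-q^{-2}) acts as the scalar
  vgamma/(q+q^{-1}), the action of C is determined by those of A and B.\<close>

definition Vn_space :: "nat \<Rightarrow> (nat \<Rightarrow> 'a::field) set" where
  "Vn_space n = {f. \<forall>i > n. f i = 0}"

definition Vn_A :: "'a::field \<Rightarrow> 'a \<Rightarrow> 'a \<Rightarrow> 'a \<Rightarrow> nat \<Rightarrow> (nat \<Rightarrow> 'a) \<Rightarrow> (nat \<Rightarrow> 'a)" where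
  "Vn_A q a b c n f = (\<lambda>j. if j \<le> n then
      vth q a (q ^ n) j * f j + (if j = 0 then 0 else f (j - 1)) else 0)"

definition Vn_B :: "'a::field \<Rightarrow> 'a \<Rightarrow> 'a \<Rightarrow> 'a \<Rightarrow> nat \<Rightarrow> (nat \<Rightarrow> 'a) \<Rightarrow> (nat \<Rightarrow> 'a)" where
  "Vn_B q a b c n f = (\<lambda>j. if j \<le> n then
      vth q b (q ^ n) j * f j + (if j < n then vphi q a b c (q ^ n) (j + 1) * f (j + 1) else 0)
    else 0)"

definition Vn_C :: "'a::field \<Rightarrow> 'a \<Rightarrow> 'a \<Rightarrow> 'a \<Rightarrow> nat \<Rightarrow> (nat \<Rightarrow> 'a) \<Rightarrow> (nat \<Rightarrow> 'a)" where
  "Vn_C q a b c n f = (\<lambda>j.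
      vgamma q a b c (q ^ n) * inverse (q + inverse q) * f j
      - inverse (q^2 - inverse q ^ 2) *
        (q * Vn_A q a b c n (Vn_B q a b c n f) j - inverse q * Vn_B q a b c n (Vn_A q a b c n f) j))"

definition iso_to_Vn :: "'a::field \<Rightarrow> ('a \<Rightarrow> 'v::ab_group_add \<Rightarrow> 'v)
    \<Rightarrow> ('v \<Rightarrow> 'v) \<Rightarrow> ('v \<Rightarrow> 'v) \<Rightarrow> ('v \<Rightarrow> 'v) \<Rightarrow> 'a \<Rightarrow> 'a \<Rightarrow> 'a \<Rightarrow> nat \<Rightarrow> bool" where
  "iso_to_Vn q scale A B C a b c n \<longleftrightarrow>
     (\<exists>T :: 'v \<Rightarrow> nat \<Rightarrow> 'a.
        bij_betw T UNIV (Vn_space n) \<and>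
        (\<forall>x y. T (x + y) = (\<lambda>i. T x i + T y i)) \<and>
        (\<forall>s x. T (scale s x) = (\<lambda>i. s * T x i)) \<and>
        (\<forall>x. T (A x) = Vn_A q a b c n (T x)) \<and>
        (\<forall>x. T (B x) = Vn_B q a b c n (T x)) \<and>
        (\<forall>x. T (C x) = Vn_C q a b c n (T x)))"

end

(* By Schur's lemma the central elements act as scalars, so A and B satisfy the two Askey-Wilson
   relations, and V is irreducible under A and B alone. The relations force B to have an
   eigenvector v with eigenvalue y + 1/y such that the Krylov flag of v under A is triangular for
   B, with eigenvalues y q^(2i) + 1/(y q^(2i)): otherwise the generalized eigenspaces of B along a
   q^2-orbit would have total dimension at least d'. Likewise there is such a vector w for A. The
   flags generated by v and w are opposite, and m_0 = v, m_(i+1) = (A - theta_i) m_i is a basis in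
   which A is lower and B is upper bidiagonal. The off-diagonal entries phi_i of B satisfy a
   second-order linear recurrence with constant term. Choosing c so that phi_1 has the prescribed
   value, the vanishing of phi_0 and phi_(n+1) determines the constant term, hence all phi_i and
   gamma, because 0 < n < n + 1 < d'; for n = 0 it is gamma that determines c. *)

theory Submission
  imports Defs
begin

text \<open>Since q is a root of unity, the values \<open>jouk (x * q ^ (2 * i))\<close> can
  coincide even for indices below d', so neither A nor B need be diagonalizable; the argument works
  with flags rather than eigenbases. Orbits appear because, on \<open>A v\<close> for an eigenvector
  v of B and up to the line of v, the Askey-Wilson relation is a quadratic in B whose roots are the
  two neighbours of the eigenvalue in its orbit. If one of the two factors suffices, the Krylov flag
  starts off triangular, and the three-term recurrence of \<open>jouk\<close> along the orbit keeps
  it so. The flags are opposite because A acts by scalars on the successive quotients of the flag of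
  w, and a is chosen such that A - theta_i removes the top quotient at step i. The parameter c
  enters phi_1 and gamma affinely, through \<open>jouk c\<close>, so algebraic closedness supplies
  it. The difference between phi_i and the required value is then a multiple of jouk (q^(2i-1)) -
  jouk q, which is nonzero at i = n + 1.\<close>

text \<open>The Joukowski map; all $\theta_i$ and $\theta_i^*$ are among its values.\<close>

definition jouk :: "'a::field \<Rightarrow> 'a" where
  "jouk x = x + inverse x"

lemma jouk_inverse [simp]: "jouk (inverse x) = jouk x"
  by (simp add: jouk_def add.commute)

lemma jouk_eq_iff:
  assumes "x \<noteq> 0" "y \<noteq> 0"
  shows "jouk x = jouk y \<longleftrightarrow> x = y \<or> x * y = 1"
proof -
  have "(jouk x - jouk y) * (x * y) = (x - y) * (x * y - 1)"
    using assms by (simp add: jouk_def field_simps)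
  then show ?thesis
    using assms by (metis diff_eq_diff_eq mult_eq_0_iff right_minus_eq)
qed

text \<open>The product-to-sum formula. It yields the three-term recurrence, with coefficient jouk
  (q^2), satisfied by the values of \<open>jouk\<close> along an orbit.\<close>

lemma jouk_mult:
  assumes "x \<noteq> 0" "y \<noteq> 0"
  shows "jouk x * jouk y = jouk (x * y) + jouk (x / y)"
  using assms by (simp add: jouk_def field_simps)

lemma jouk_surj:
  fixes t :: "'a::alg_closed_field"
  obtains x where "x \<noteq> 0" "jouk x = t"
proof -
  have "degree [:1, - t, 1:] > 0"
    by simp
  then obtain x where "poly [:1, - t, 1:] x = 0"
    using alg_closed_imp_poly_has_root by blast
  then have x: "x * x + 1 = t * x"
    by (simp add: algebra_simps)
  then have "x \<noteq> 0"
    by auto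
  with x have "jouk x = t"
    by (simp add: jouk_def field_simps)
  with \<open>x \<noteq> 0\<close> that show ?thesis by blast
qed

section \<open>Operators on finite-dimensional spaces\<close>

locale lin_op = vector_space scale
  for scale :: "'a::field \<Rightarrow> 'v::ab_group_add \<Rightarrow> 'v" (infixr "*s" 75) +
  fixes f :: "'v \<Rightarrow> 'v"
  assumes op_add: "f (x + y) = f x + f y"
    and op_scale: "f (c *s x) = c *s f x"
begin

lemma op_zero: "f 0 = 0"
  using op_scale[of 0 0] by simp

lemma op_neg: "f (- x) = - f x"
  using op_scale[of "-1" x] by simp

lemma op_diff: "f (x - y) = f x - f y"
  using op_add[of x "- y"] by (simp add: op_neg)

lemmas op_simps = op_add op_scale op_zero op_neg op_diff

lemma op_span_subset:
  assumes "\<And>x. x \<in> S \<Longrightarrow> f x \<in> W" "subspace W" "v \<in> span S"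
  shows "f v \<in> W"
proof -
  have "subspace {v. f v \<in> W}"
    using assms(2) by (auto simp: subspace_def op_simps)
  moreover have "S \<subseteq> {v. f v \<in> W}"
    using assms(1) by auto
  ultimately show ?thesis
    using span_minimal assms(3) by blast
qed

definition polyop :: "'a poly \<Rightarrow> 'v \<Rightarrow> 'v" where
  "polyop p v = fold_coeffs (\<lambda>a w. a *s v + f w) p 0"

lemma polyop_0 [simp]: "polyop 0 v = 0"
  by (simp add: polyop_def)

lemma polyop_pCons [simp]: "polyop (pCons a p) v = a *s v + f (polyop p v)"
  by (cases "p = 0 \<and> a = 0") (auto simp: polyop_def op_zero)

lemma polyop_add: "polyop (p + r) v = polyop p v + polyop r v"
  by (induction p r rule: poly_induct2) (simp_all add: op_add scale_left_distrib)

lemma polyop_smult: "polyop (smult c p) v = c *s polyop p v"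
  by (induction p) (simp_all add: op_simps scale_right_distrib)

lemma polyop_linear_factor: "polyop ([:- r, 1:] * p) v = f (polyop p v) - r *s polyop p v"
proof -
  have "[:- r, 1:] * p = smult (- r) p + pCons 0 p"
    by simp
  then show ?thesis
    by (simp only: polyop_add polyop_smult polyop_pCons) simp
qed

lemma polyop_monom: "polyop (monom c n) v = c *s (f ^^ n) v"
  by (induction n) (simp_all add: monom_Suc monom_0 op_simps)

lemma polyop_sum: "polyop (sum p I) v = (\<Sum>i\<in>I. polyop (p i) v)"
  by (induction I rule: infinite_finite_induct) (simp_all add: polyop_add)

end

text \<open>Roots are split off one at a time; the first quotient that no longer annihilates v
  produces the eigenvector. The locale fixes a mere field, so \<open>alg\<close> supplies algebraic
  closedness.\<close>

lemma (in lin_op) eigenvector_of_polyop: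
  fixes p :: "'a poly"
  assumes alg: "\<And>p :: 'a poly. degree p > 0 \<Longrightarrow> \<exists>x. poly p x = 0"
    and "p \<noteq> 0" "v \<noteq> 0" "polyop p v = 0"
  shows "\<exists>u r. u \<noteq> 0 \<and> f u = r *s u"
  using assms(2-)
proof (induction "degree p" arbitrary: p)
  case 0
  then obtain c where "p = [:c:]" "c \<noteq> 0"
    by (metis degree_eq_zeroE pCons_0_0)
  with 0 show ?case by (simp add: op_zero)
next
  case (Suc n)
  then obtain r where "poly p r = 0"
    using alg[of p] by auto
  then obtain p' where p': "p = [:- r, 1:] * p'"
    by (metis dvdE poly_eq_0_iff_dvd)
  with Suc.prems have "p' \<noteq> 0"
    by auto
  then have "degree p' = n"
    using Suc.hyps(2) p' by (subst (asm) p', subst (asm) degree_mult_eq) auto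
  show ?case
  proof (cases "polyop p' v = 0")
    case True
    then show ?thesis
      using Suc.hyps(1) \<open>degree p' = n\<close> \<open>p' \<noteq> 0\<close> Suc.prems by blast
  next
    case False
    then show ?thesis
      using Suc.prems(3) unfolding p' polyop_linear_factor by auto
  qed
qed

text \<open>The relation is monic in \<open>w N\<close>, so for powers of an operator it gives a
  nonzero annihilating polynomial.\<close>

lemma (in vector_space) finite_span_relation:
  fixes w :: "nat \<Rightarrow> 'b"
  assumes "finite S" "span S = UNIV"
  shows "\<exists>N g. w N = (\<Sum>i<N. g i *s w i)"
proof -
  have "\<exists>N. w N \<in> span (w ` {..<N})"
  proof (rule ccontr)
    assume *: "\<not> ?thesis"
    have indep: "independent (w ` {..<n}) \<and> card (w ` {..<n}) = n" for n
    proof (induction n)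
      case (Suc n)
      have n: "w n \<notin> span (w ` {..<n})" using * by simp
      then have "w n \<notin> w ` {..<n}" using span_base[of "w n"] by metis
      with n Suc show ?case
        by (simp add: lessThan_Suc independent_insertI)
    qed (simp add: independent_empty)
    let ?W = "w ` {..<Suc (card S)}"
    have "card ?W \<le> card S"
    proof (rule independent_span_bound[THEN conjunct2])
      show "independent ?W" using indep by blast
      show "?W \<subseteq> span S" unfolding assms(2) by (rule subset_UNIV)
    qed (rule assms(1))
    moreover have "card ?W = Suc (card S)" using indep by blast
    ultimately have "Suc (card S) \<le> card S" by (simp only:)
    then show False by simp
  qed
  then obtain N where "w N \<in> span (w ` {..<N})" by blast
  moreover have "span (w ` {..<N}) \<subseteq> {v. \<exists>g. v = (\<Sum>i<N. g i *s w i)}"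
  proof (rule span_minimal)
    have w: "w i = (\<Sum>j<N. (if j = i then 1 else 0) *s w j)" if "i < N" for i
    proof -
      have "(\<Sum>j<N. (if j = i then 1 else 0) *s w j) = (\<Sum>j<N. if j = i then w j else 0)"
        by (rule sum.cong) auto
      then show ?thesis using that by simp
    qed
    show "w ` {..<N} \<subseteq> {v. \<exists>g. v = (\<Sum>i<N. g i *s w i)}"
      by (intro image_subsetI CollectI exI) (rule w, simp)
    show "subspace {v. \<exists>g. v = (\<Sum>i<N. g i *s w i)}"
      unfolding subspace_def
    proof safe
      show "\<exists>g. 0 = (\<Sum>i<N. g i *s w i)"
        by (rule exI[of _ "\<lambda>_. 0"]) simp
      show "\<exists>k. (\<Sum>i<N. g i *s w i) + (\<Sum>i<N. h i *s w i) = (\<Sum>i<N. k i *s w i)" for g h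
        by (rule exI[of _ "\<lambda>i. g i + h i"]) (simp add: scale_left_distrib sum.distrib)
      show "\<exists>k. c *s (\<Sum>i<N. g i *s w i) = (\<Sum>i<N. k i *s w i)" for c g
        by (rule exI[of _ "\<lambda>i. c * g i"]) (simp add: scale_sum_right)
    qed
  qed
  ultimately show ?thesis
    by blast
qed

lemma eigenvector_exists:
  fixes scale :: "'a::alg_closed_field \<Rightarrow> 'v::ab_group_add \<Rightarrow> 'v"
  assumes "lin_op scale f" "fin_dim scale" "(UNIV :: 'v set) \<noteq> {0}"
  shows "\<exists>u r. u \<noteq> 0 \<and> f u = scale r u"
proof -
  interpret lin_op scale f by fact
  obtain v :: 'v where "v \<noteq> 0"
    using assms(3) by blast
  obtain N g where g: "(f ^^ N) v = (\<Sum>i<N. scale (g i) ((f ^^ i) v))"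
    using assms(2) finite_span_relation[of _ "\<lambda>i. (f ^^ i) v"] unfolding fin_dim_def by blast
  define p where "p = monom 1 N + (\<Sum>i<N. monom (- g i) i)"
  have "coeff p N = 1"
    by (simp add: p_def coeff_sum)
  then have "p \<noteq> 0" by auto
  moreover have "polyop p v = 0"
    by (simp add: p_def polyop_add polyop_sum polyop_monom g sum_negf)
  ultimately show ?thesis
    using eigenvector_of_polyop[OF alg_closed_imp_poly_has_root] \<open>v \<noteq> 0\<close> by blast
qed

section \<open>Independence of generalized eigenspaces\<close>

context lin_op
begin

definition shift :: "'a \<Rightarrow> 'v \<Rightarrow> 'v" where
  "shift r v = f v - r *s v"

lemma shift_add: "shift r (v + w) = shift r v + shift r w"
  by (simp add: shift_def op_add scale_right_distrib)

lemma shift_scale: "shift r (c *s v) = c *s shift r v"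
  by (simp add: shift_def op_scale scale_right_diff_distrib mult.commute)

lemma shift_zero: "shift r 0 = 0"
  by (simp add: shift_def op_zero)

lemma shift_diff: "shift r (v - w) = shift r v - shift r w"
  by (simp add: shift_def op_diff scale_right_diff_distrib)

lemmas shift_simps = shift_add shift_scale shift_zero shift_diff

lemma lin_op_shift: "lin_op scale (shift r)"
  by unfold_locales (simp_all add: shift_simps)

lemma shift_commute: "shift r (shift s v) = shift s (shift r v)"
  by (simp add: shift_def op_simps scale_right_diff_distrib mult.commute)

lemma shift_f: "shift r (f v) = f (shift r v)"
  by (simp add: shift_def op_simps)

lemma shift_eq_0_iff: "shift r v = 0 \<longleftrightarrow> f v = r *s v"
  by (simp add: shift_def)

lemma shift_eigen: "shift s v = 0 \<Longrightarrow> shift r v = (s - r) *s v"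
  by (simp add: shift_def scale_left_diff_distrib)

text \<open>Depth two is enough: the later count needs at most two dimensions per
  eigenvalue.\<close>

definition gker :: "'a \<Rightarrow> 'v set" where
  "gker r = {v. shift r (shift r v) = 0}"

lemma subspace_gker: "subspace (gker r)"
  by (auto simp: gker_def subspace_def shift_simps)

end

locale fd_op = finite_dimensional_vector_space scale Basis + lin_op scale f
  for scale :: "'a::field \<Rightarrow> 'v::ab_group_add \<Rightarrow> 'v" (infixr "*s" 75) and Basis f
begin

text \<open>The induction carries the sum S of the spaces treated so far and the product F of the
  squared shifts. F kills S but is injective on the space of every other eigenvalue, so each new
  space meets S only in 0.\<close>

lemma sum_dim_gker_le:
  assumes "finite I" "inj_on u I" "\<And>i. i \<in> I \<Longrightarrow> m i \<le> dim (gker (u i))"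
  shows "sum m I \<le> dim UNIV"
proof -
  have "\<exists>S F. subspace S \<and> lin_op scale F \<and> (\<forall>r v. F (shift r v) = shift r (F v)) \<and>
      (\<forall>v\<in>S. F v = 0) \<and> (\<forall>r v. r \<notin> u ` I \<longrightarrow> v \<in> gker r \<longrightarrow> F v = 0 \<longrightarrow> v = 0) \<and>
      sum m I \<le> dim S"
    using assms
  proof (induction I)
    case empty
    have "lin_op scale (\<lambda>v. v)"
      by unfold_locales auto
    then show ?case
      by (intro exI[of _ "{0}"] exI[of _ "\<lambda>v. v"]) (auto simp: subspace_single_0)
  next
    case (insert i I)
    then obtain S F where S: "subspace S" "lin_op scale F" "\<And>r v. F (shift r v) = shift r (F v)"
      "\<And>v. v \<in> S \<Longrightarrow> F v = 0" "\<And>r v. r \<notin> u ` I \<Longrightarrow> v \<in> gker r \<Longrightarrow> F v = 0 \<Longrightarrow> v = 0"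
      "sum m I \<le> dim S"
      by (auto simp: inj_on_insert)
    interpret F: lin_op scale F by fact
    let ?K = "gker (u i)"
    let ?S = "{x + y |x y. x \<in> S \<and> y \<in> ?K}"
    let ?F = "\<lambda>v. F (shift (u i) (shift (u i) v))"
    have "u i \<notin> u ` I"
      using insert by (auto simp: inj_on_def)
    then have "S \<inter> ?K = {0}"
      using S(4,5) subspace_0[OF S(1)] subspace_0[OF subspace_gker] by blast
    then have "dim ?S = dim S + dim ?K"
      using dim_sums_Int[OF S(1) subspace_gker[of "u i"]] by simp
    then have "sum m (insert i I) \<le> dim ?S"
      using insert.hyps insert.prems(2)[of i] S(6) by simp
    moreover have "subspace ?S"
      using subspace_sums[OF S(1) subspace_gker] .
    moreover have "lin_op scale ?F"
      by unfold_locales (simp_all add: shift_simps F.op_simps)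
    moreover have "?F (shift r v) = shift r (?F v)" for r v
      by (simp add: S(3) shift_commute[of r])
    moreover have "?F v = 0" if v: "v \<in> ?S" for v
    proof -
      obtain x y where xy: "v = x + y" "x \<in> S" "y \<in> ?K"
        using v by blast
      then have "?F v = ?F x"
        by (simp add: shift_simps gker_def)
      also have "\<dots> = 0"
        using S(4)[OF xy(2)] by (simp add: S(3) shift_zero)
      finally show ?thesis .
    qed
    moreover have "v = 0" if r: "r \<notin> u ` insert i I" and v: "v \<in> gker r" and "?F v = 0" for r v
    proof -
      have inj: "t = 0" if "t \<in> gker r" "shift (u i) t = 0" for t
      proof -
        have "shift r (shift r t) = (u i - r) *s (u i - r) *s t"
          using shift_eigen[OF that(2), of r] by (simp add: shift_scale)
        then show ?thesis
          using that(1) r by (auto simp: gker_def)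
      qed
      have 1: "shift s w \<in> gker r" if "w \<in> gker r" for s w
        using that by (simp add: gker_def shift_commute[of _ s] shift_zero)
      have "shift (u i) (shift (u i) v) = 0"
        using S(5)[of r "shift (u i) (shift (u i) v)"] 1 that by auto
      then show ?thesis
        using inj 1 v by blast
    qed
    ultimately show ?case
      by (intro exI[of _ ?S] exI[of _ ?F]) blast
  qed
  then obtain S where "sum m I \<le> dim S"
    by blast
  then show ?thesis
    using dim_subset[of S UNIV] by simp
qed

end

section \<open>Existence of a good eigenvector\<close>

text \<open>The generator C is eliminated: once the central elements act as scalars, it is a
  combination of the identity, AB and BA, and the remaining defining relations become the two
  Askey--Wilson relations below, which are symmetric in A and B. The constant g is
  $-(q-q^{-1})^2\gamma$.\<close>

locale aw_pair = finite_dimensional_vector_space scale Basis + opA: lin_op scale A + opB: fd_op scale Basis B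
  for scale :: "'a::alg_closed_field \<Rightarrow> 'v::ab_group_add \<Rightarrow> 'v" (infixr "*s" 75) and Basis A B +
  fixes q g hA hB :: 'a and d' :: nat
  assumes q_nonzero: "q \<noteq> 0" and d'_ge_3: "3 \<le> d'" and q_pow: "q ^ (2 * d') = 1"
    and q_pow_neq_1: "0 < i \<Longrightarrow> i < d' \<Longrightarrow> q ^ (2 * i) \<noteq> 1"
    and relA: "A (A (B v)) - jouk (q\<^sup>2) *s A (B (A v)) + B (A (A v)) + (q\<^sup>2 - inverse (q\<^sup>2))\<^sup>2 *s B v
      = g *s A v + hA *s v"
    and relB: "B (B (A v)) - jouk (q\<^sup>2) *s B (A (B v)) + A (B (B v)) + (q\<^sup>2 - inverse (q\<^sup>2))\<^sup>2 *s A v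
      = g *s B v + hB *s v"
    and irred: "subspace W \<Longrightarrow> A ` W \<subseteq> W \<Longrightarrow> B ` W \<subseteq> W \<Longrightarrow> W = {0} \<or> W = UNIV"
    and nontrivial: "(UNIV :: 'v set) \<noteq> {0}"
    and dim_less: "dim (UNIV :: 'v set) < d'"
begin

text \<open>Carries the results on eigenvectors and flags of B over to A.\<close>

lemma aw_pair_swap: "aw_pair scale Basis B A q g hB hA d'"
  apply unfold_locales
  using q_nonzero d'_ge_3 q_pow q_pow_neq_1 relA relB irred nontrivial dim_less
  by (simp_all add: opA.op_add opA.op_scale)

lemma q_pow_eq_iff:
  assumes "i < j" "j < d' + i"
  shows "q ^ (2 * i) \<noteq> q ^ (2 * j)"
proof
  assume "q ^ (2 * i) = q ^ (2 * j)"
  also have "q ^ (2 * j) = q ^ (2 * i) * q ^ (2 * (j - i))"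
    using assms by (simp flip: power_add add_mult_distrib2)
  finally show False
    using q_pow_neq_1[of "j - i"] q_nonzero assms by simp
qed

lemma q2_neq_1: "q\<^sup>2 \<noteq> 1" and q4_neq_1: "q ^ 4 \<noteq> 1"
  using q_pow_neq_1[of 1] q_pow_neq_1[of 2] d'_ge_3 by simp_all

lemma q_minus_inverse_neq_0: "q - inverse q \<noteq> 0" and q_plus_inverse_neq_0: "q + inverse q \<noteq> 0"
proof -
  have "(q - inverse q) * q = q\<^sup>2 - 1" "(q + inverse q) * q * (q\<^sup>2 - 1) = q ^ 4 - 1"
    using q_nonzero by (simp_all add: field_simps power2_eq_square power4_eq_xxxx)
  then show "q - inverse q \<noteq> 0" "q + inverse q \<noteq> 0"
    using q2_neq_1 q4_neq_1 by auto
qed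

text \<open>For an eigenvector v with eigenvalue \<open>jouk x\<close>, the relation puts the vector
  $(B - \mathrm{jouk}(xq^2))(B - \mathrm{jouk}(xq^{-2}))Av$ into the line of v; v is good if the
  first factor alone does. Replacing x by its inverse exchanges the two factors.\<close>

definition good :: "'a \<Rightarrow> 'v \<Rightarrow> bool" where
  "good x v \<longleftrightarrow> x \<noteq> 0 \<and> v \<noteq> 0 \<and> B v = jouk x *s v \<and> (\<exists>s. opB.shift (jouk (x * q\<^sup>2)) (A v) = s *s v)"

text \<open>Vieta's formulas: for an eigenvector v with value \<open>jouk x\<close>,
  \<open>relB\<close> is a monic quadratic in B acting on \<open>A v\<close>, and these are the sum
  and the product of its roots.\<close>

lemma neighbours:
  assumes "x \<noteq> 0"
  shows "jouk (x * q\<^sup>2) + jouk (x / q\<^sup>2) = jouk x * jouk (q\<^sup>2)"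
    and "jouk (x * q\<^sup>2) * jouk (x / q\<^sup>2) = (jouk x)\<^sup>2 + (q\<^sup>2 - inverse (q\<^sup>2))\<^sup>2"
proof -
  show "jouk (x * q\<^sup>2) + jouk (x / q\<^sup>2) = jouk x * jouk (q\<^sup>2)"
    using assms q_nonzero by (simp add: jouk_mult)
  show "jouk (x * q\<^sup>2) * jouk (x / q\<^sup>2) = (jouk x)\<^sup>2 + (q\<^sup>2 - inverse (q\<^sup>2))\<^sup>2"
    using assms q_nonzero by (simp add: jouk_def field_simps power2_eq_square)
qed

text \<open>This is \<open>relB\<close> with its quadratic factored by \<open>neighbours\<close>.
  The terms in w, absent for an eigenvector, are what a Jordan chain contributes in
  \<open>two_step\<close>.\<close>

lemma shift_shift_A:
  assumes "x \<noteq> 0" "opB.shift (jouk x) v = w"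
  shows "opB.shift (jouk (x * q\<^sup>2)) (opB.shift (jouk (x / q\<^sup>2)) (A v))
    = jouk (q\<^sup>2) *s B (A w) - jouk x *s A w - A (B w) + g *s B v + hB *s v"
proof -
  have Bv: "B v = jouk x *s v + w"
    using assms(2) by (auto simp: opB.shift_def)
  have "opB.shift (jouk (x * q\<^sup>2)) (opB.shift (jouk (x / q\<^sup>2)) (A v))
    = B (B (A v)) - (jouk (x * q\<^sup>2) + jouk (x / q\<^sup>2)) *s B (A v) + (jouk (x * q\<^sup>2) * jouk (x / q\<^sup>2)) *s A v"
    by (simp add: opB.shift_def opB.op_simps scale_right_diff_distrib scale_left_distrib)
  also have "\<dots> = B (B (A v)) - (jouk x * jouk (q\<^sup>2)) *s B (A v)
      + ((jouk x)\<^sup>2 + (q\<^sup>2 - inverse (q\<^sup>2))\<^sup>2) *s A v"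
    using assms(1) by (simp add: neighbours)
  also have "\<dots> = (B (B (A v)) - jouk (q\<^sup>2) *s B (A (B v)) + A (B (B v)) + (q\<^sup>2 - inverse (q\<^sup>2))\<^sup>2 *s A v)
     + (jouk (q\<^sup>2) *s B (A w) - jouk x *s A w - A (B w))"
    by (simp add: Bv opB.op_simps opA.op_simps scale_right_distrib scale_left_distrib
        power2_eq_square[of "jouk x"] mult.commute)
  finally show ?thesis
    by (simp add: relB)
qed


text \<open>If no eigenvector is good, the eigenvalues propagate along the whole orbit $xq^{2i}$.
  When $x^2$ is a power of $q^2$, the orbit is folded by \<open>jouk\<close> to about half its size, and the
  loss is compensated by generalized eigenspaces of dimension two; the dimensions always add up
  to at least \<open>d'\<close>.\<close>

definition two :: "'a \<Rightarrow> bool" where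
  "two r \<longleftrightarrow> (\<exists>v w. v \<in> opB.gker r \<and> w \<in> opB.gker r \<and> v \<noteq> 0 \<and> (\<forall>s. w \<noteq> s *s v))"

text \<open>With c = 0 this covers two independent eigenvectors, with c nonzero a Jordan
  chain.\<close>

lemma twoI:
  assumes "v \<noteq> 0" "opB.shift r v = 0" "opB.shift r w = c *s v" "\<And>s. w \<noteq> s *s v"
  shows "two r"
  unfolding two_def opB.gker_def using assms
  by (intro exI[of _ v] exI[of _ w]) (auto simp: opB.shift_simps)

lemma dim_gker_ge_2:
  assumes "two r"
  shows "2 \<le> dim (opB.gker r)"
proof -
  obtain v w where vw: "v \<in> opB.gker r" "w \<in> opB.gker r" "v \<noteq> 0" "\<And>s. w \<noteq> s *s v"
    using assms unfolding two_def by blast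
  then have "w \<notin> span {v}"
    by (auto simp: span_singleton)
  moreover from this have "w \<noteq> v"
    using span_base[of w "{v}"] by auto
  moreover have "independent {v}"
    using vw(3) by simp
  ultimately have "independent {w, v}" "card {w, v} = 2"
    by (simp_all add: independent_insertI)
  then show ?thesis
    using independent_card_le_dim[of "{w, v}" "opB.gker r"] vw by auto
qed

context
  assumes no_good: "\<And>x v. \<not> good x v"
begin

lemma not_good:
  assumes "x \<noteq> 0" "v \<noteq> 0" "opB.shift (jouk x) v = 0"
  shows "opB.shift (jouk (x * q\<^sup>2)) (A v) \<noteq> s *s v" "opB.shift (jouk (x / q\<^sup>2)) (A v) \<noteq> s *s v"
proof -
  show "opB.shift (jouk (x * q\<^sup>2)) (A v) \<noteq> s *s v"
    using no_good[of x v] assms unfolding good_def by (auto simp: opB.shift_eq_0_iff)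
  have "inverse x * q\<^sup>2 = inverse (x / q\<^sup>2)"
    using assms q_nonzero by (simp add: field_simps)
  then have "jouk (inverse x * q\<^sup>2) = jouk (x / q\<^sup>2)"
    by (simp only: jouk_inverse)
  then show "opB.shift (jouk (x / q\<^sup>2)) (A v) \<noteq> s *s v"
    using no_good[of "inverse x" v] assms unfolding good_def by (auto simp: opB.shift_eq_0_iff)
qed

lemma shift_shift_A_eigen:
  assumes "x \<noteq> 0" "opB.shift (jouk x) v = 0"
  shows "opB.shift (jouk (x * q\<^sup>2)) (opB.shift (jouk (x / q\<^sup>2)) (A v)) = (g * jouk x + hB) *s v"
  using shift_shift_A[OF assms] assms(2)
  by (simp add: opB.shift_eq_0_iff opB.op_simps opA.op_simps scale_left_distrib)

text \<open>The factor B - jouk (x q^2) maps t = (B - jouk (x / q^2)) A v into the line of v, which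
  B - jouk x kills. If t itself were killed by B - jouk x, the first factor would act on t as a
  nonzero scalar, so t would lie in the line of v, against \<open>not_good\<close>.\<close>

lemma eigenvector_step:
  assumes "x \<noteq> 0" "jouk x \<noteq> jouk (x * q\<^sup>2)" "v \<noteq> 0" "opB.shift (jouk x) v = 0"
    and y: "y = opB.shift (jouk x) (opB.shift (jouk (x / q\<^sup>2)) (A v))"
  shows "y \<noteq> 0" "opB.shift (jouk (x * q\<^sup>2)) y = 0"
proof -
  let ?t = "opB.shift (jouk (x / q\<^sup>2)) (A v)"
  have t: "opB.shift (jouk (x * q\<^sup>2)) ?t = (g * jouk x + hB) *s v"
    using assms(1,4) by (rule shift_shift_A_eigen)
  then show "opB.shift (jouk (x * q\<^sup>2)) y = 0"
    unfolding y using assms(4) by (simp add: opB.shift_commute[of _ "jouk x"] opB.shift_simps)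
  show "y \<noteq> 0"
  proof
    assume "y = 0"
    then have "(jouk x - jouk (x * q\<^sup>2)) *s ?t = (g * jouk x + hB) *s v"
      using t opB.shift_eigen unfolding y by metis
    then have "?t = (inverse (jouk x - jouk (x * q\<^sup>2)) * (g * jouk x + hB)) *s v"
      using assms(2) by (metis (no_types, lifting) scale_scale right_minus_eq left_inverse scale_one)
    then show False
      using not_good(2)[OF assms(1,3,4)] by blast
  qed
qed

text \<open>Two independent eigenvectors are moved by the map of \<open>eigenvector_step\<close>,
  which is injective on the eigenspace. Otherwise there is a Jordan chain v0, v1: v0 moves to the
  eigenvector y, and a polynomial in B applied to \<open>A v1\<close> gives a vector above y in a
  Jordan chain.\<close>

lemma two_step:
  assumes x: "x \<noteq> 0" "jouk x \<noteq> jouk (x * q\<^sup>2)" "x\<^sup>2 * q ^ 4 \<noteq> 1" and "two (jouk x)"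
  shows "two (jouk (x * q\<^sup>2))"
proof -
  let ?u = "jouk x" and ?up = "jouk (x * q\<^sup>2)" and ?um = "jouk (x / q\<^sup>2)"
  obtain a b where ab: "a \<in> opB.gker ?u" "b \<in> opB.gker ?u" "a \<noteq> 0" "\<And>s. b \<noteq> s *s a"
    using assms(4) unfolding two_def by blast
  show ?thesis
  proof (cases "opB.shift ?u a = 0 \<and> opB.shift ?u b = 0")
    case True
    let ?y = "\<lambda>v. opB.shift ?u (opB.shift ?um (A v))"
    show ?thesis
    proof (rule twoI)
      show "?y a \<noteq> 0" "opB.shift ?up (?y a) = 0"
        using eigenvector_step[OF x(1,2) ab(3) _ refl] True by auto
      have "b \<noteq> 0"
        using ab(4)[of 0] by auto
      then show "opB.shift ?up (?y b) = 0 *s ?y a"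
        using eigenvector_step(2)[OF x(1,2) _ _ refl, of b] True by simp
      fix s
      have "b - s *s a \<noteq> 0" "opB.shift ?u (b - s *s a) = 0"
        using ab(4)[of s] True by (auto simp: opB.shift_simps)
      then have "?y (b - s *s a) \<noteq> 0"
        using eigenvector_step(1)[OF x(1,2) _ _ refl] by blast
      then show "?y b \<noteq> s *s ?y a"
        by (auto simp: opB.shift_simps opA.op_simps)
    qed
  next
    case False
    then obtain v1 where v1: "v1 \<in> opB.gker ?u" "opB.shift ?u v1 \<noteq> 0"
      using ab by blast
    define v0 where "v0 = opB.shift ?u v1"
    have v0: "v0 \<noteq> 0" "opB.shift ?u v0 = 0"
      using v1 by (auto simp: v0_def opB.gker_def)
    define y where "y = opB.shift ?u (opB.shift ?um (A v0))"
    note y = eigenvector_step[OF x(1,2) v0 y_def]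
    \<comment> \<open>D annihilates the Jordan chain v0, v1, so only the terms in A v0 survive.\<close>
    define D where "D v = opB.shift ?um (opB.shift ?u (opB.shift ?u v))" for v
    interpret D: lin_op scale D
      by unfold_locales (simp_all add: D_def opB.shift_simps)
    have D_B: "D (B v) = B (D v)" for v
      by (simp add: D_def opB.shift_f)
    have D_v: "D v1 = 0"
      using v0(2) by (simp add: D_def opB.shift_simps flip: v0_def)
    have "D (A v0) = opB.shift ?u y"
      by (simp add: D_def y_def opB.shift_commute[of _ ?um])
    also have "\<dots> = (?up - ?u) *s y"
      using y(2) by (rule opB.shift_eigen)
    finally have D_A: "D (A v0) = (?up - ?u) *s y" .
    have By: "B y = ?up *s y"
      using y(2) by (simp add: opB.shift_eq_0_iff)
    let ?z = "D (opB.shift ?um (A v1))"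
    have "opB.shift ?up ?z = D (opB.shift ?up (opB.shift ?um (A v1)))"
      by (simp add: D_def opB.shift_commute[of _ ?up])
    also have "\<dots> = jouk (q\<^sup>2) *s B (D (A v0)) - ?u *s D (A v0) - D (A (B v0)) + (g *s B (D v1) + hB *s D v1)"
      by (simp add: shift_shift_A[OF x(1) v0_def[symmetric]] D.op_simps D_B)
    also have "B v0 = ?u *s v0"
      using v0(2) by (simp add: opB.shift_eq_0_iff)
    finally have "opB.shift ?up ?z = (jouk (q\<^sup>2) * (?up - ?u) * ?up) *s y
        - (?u * (?up - ?u)) *s y - ((?up - ?u) * ?u) *s y"
      by (simp add: opA.op_simps opB.op_simps D.op_simps D_A D_v By mult_ac)
    then have z: "opB.shift ?up ?z = ((?up - ?u) * (jouk (q\<^sup>2) * ?up - 2 * ?u)) *s y"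
      by (simp only: scale_left_diff_distrib[symmetric]) (simp add: algebra_simps)
    have "x * q\<^sup>2 * q\<^sup>2 = x * q ^ 4" "x * q\<^sup>2 / q\<^sup>2 = x"
      using q_nonzero by (simp_all add: mult.assoc flip: power_add)
    then have "jouk (q\<^sup>2) * ?up = jouk (x * q ^ 4) + ?u"
      using jouk_mult[of "x * q\<^sup>2" "q\<^sup>2"] x(1) q_nonzero
      by (simp only: mult.commute[of "jouk (q\<^sup>2)"]) simp
    \<comment> \<open>The coefficient of y in \<open>z\<close> is thus \<open>?up - ?u\<close> times
      \<open>jouk (x * q ^ 4) - ?u\<close>, the difference of orbit values two steps apart.\<close>
    moreover have "jouk (x * q ^ 4) \<noteq> ?u"
      using x(1,3) q4_neq_1 q_nonzero by (simp add: jouk_eq_iff power2_eq_square mult_ac)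
    ultimately have c: "(?up - ?u) * (jouk (q\<^sup>2) * ?up - 2 * ?u) \<noteq> 0"
      using x(2) by auto
    show ?thesis
    proof (rule twoI[OF y z])
      fix s
      show "?z \<noteq> s *s y"
      proof
        assume "?z = s *s y"
        then have "opB.shift ?up ?z = 0"
          using y(2) by (simp add: opB.shift_simps)
        with z c y(1) show False
          by simp
      qed
    qed
  qed
qed

text \<open>For x = 1/x both neighbours of \<open>jouk x\<close> are the same value r, and (B - r)^2
  A v lies in the line of v. Subtracting the right multiple of v from A v gives w with (B - r)^2 w =
  0, and \<open>not_good\<close> makes (B - r) w nonzero.\<close>

lemma two_of_square_1:
  assumes "x\<^sup>2 = 1" "v \<noteq> 0" "opB.shift (jouk x) v = 0"
  shows "two (jouk (x * q\<^sup>2))"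
proof -
  let ?u = "jouk x" and ?up = "jouk (x * q\<^sup>2)"
  have x: "x \<noteq> 0" "inverse x = x"
    using assms(1) by (auto simp: power2_eq_square inverse_unique)
  have "jouk (x / q\<^sup>2) = jouk (inverse (x / q\<^sup>2))"
    by (simp only: jouk_inverse)
  then have um: "jouk (x / q\<^sup>2) = ?up"
    using x by (simp add: divide_inverse mult.commute)
  have "x * (x * q\<^sup>2) = q\<^sup>2"
    using assms(1) by (simp add: power2_eq_square flip: mult.assoc)
  then have "x * (x * q\<^sup>2) \<noteq> 1"
    using q2_neq_1 by (simp only: not_False_eq_True)
  moreover have "x \<noteq> x * q\<^sup>2" "x * q\<^sup>2 \<noteq> 0"
    using x(1) q2_neq_1 q_nonzero by auto
  ultimately have ne: "?u \<noteq> ?up"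
    using x(1) jouk_eq_iff by blast
  define c where "c = (g * ?u + hB) / (?u - ?up)\<^sup>2"
  define w where "w = A v - c *s v"
  have v: "opB.shift ?up v = (?u - ?up) *s v"
    using assms(3) by (rule opB.shift_eigen)
  have "opB.shift ?up (opB.shift ?up w) = (g * ?u + hB) *s v - (c * (?u - ?up)\<^sup>2) *s v"
    using shift_shift_A_eigen[OF x(1) assms(3)] v
    by (simp add: um w_def opB.shift_simps power2_eq_square[of "_ - _"] mult.assoc)
  then have 2: "opB.shift ?up (opB.shift ?up w) = 0"
    using ne by (simp add: c_def)
  have "opB.shift ?up (A v) \<noteq> (c * (?u - ?up)) *s v"
    using not_good[OF x(1) assms(2,3)] by blast
  then have 1: "opB.shift ?up w \<noteq> 0"
    using v by (simp add: w_def opB.shift_simps)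
  show ?thesis
    using 1 2 by (intro twoI[of "opB.shift ?up w" _ w 1]) (auto, metis opB.shift_scale scale_zero_right)
qed

text \<open>Here x / q^2 is the inverse of x, so \<open>jouk x\<close> is its own neighbour: B -
  jouk x maps (B - jouk (x q^2)) A v into the line of v, while that vector is outside the
  line.\<close>

lemma two_of_square_q2:
  assumes "x\<^sup>2 = q\<^sup>2" "v \<noteq> 0" "opB.shift (jouk x) v = 0"
  shows "two (jouk x)"
proof -
  have x: "x \<noteq> 0"
    using assms(1) q_nonzero by auto
  have "x / q\<^sup>2 = inverse x"
    using x unfolding assms(1)[symmetric] by (simp add: power2_eq_square divide_simps)
  then have um: "jouk (x / q\<^sup>2) = jouk x"
    by simp
  show ?thesis
  proof (rule twoI[OF assms(2,3)])
    show "opB.shift (jouk x) (opB.shift (jouk (x * q\<^sup>2)) (A v)) = (g * jouk x + hB) *s v"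
      using shift_shift_A_eigen[OF x assms(3)] by (simp add: um opB.shift_commute)
    show "opB.shift (jouk (x * q\<^sup>2)) (A v) \<noteq> s *s v" for s
      using not_good[OF x assms(2,3)] by blast
  qed
qed

section \<open>Counting dimensions along an orbit\<close>

lemma eigenvector_orbit:
  assumes "x \<noteq> 0" "v \<noteq> 0" "opB.shift (jouk x) v = 0"
  shows "\<exists>v. v \<noteq> 0 \<and> opB.shift (jouk (x * q ^ (2 * i))) v = 0"
proof (induction i)
  case 0
  then show ?case using assms by auto
next
  case (Suc i)
  have eq: "x * q ^ (2 * i) * q\<^sup>2 = x * q ^ (2 * Suc i)"
    by (simp add: mult.assoc power2_eq_square mult_ac)
  have "x * q ^ (2 * i) \<noteq> 0"
    using assms(1) q_nonzero by simp
  \<comment> \<open>If two consecutive values agree, the old vector serves; otherwise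
    \<open>eigenvector_step\<close> applies.\<close>
  then show ?case
    using Suc eigenvector_step[of "x * q ^ (2 * i)"] unfolding eq by metis
qed

lemma dim_gker_ge_1:
  assumes "v \<noteq> 0" "opB.shift r v = 0"
  shows "1 \<le> dim (opB.gker r)"
proof -
  have "v \<in> opB.gker r"
    using assms by (simp add: opB.gker_def opB.shift_zero)
  then show ?thesis
    using assms(1) dim_eq_0[of "opB.gker r"] by (metis less_one linorder_not_less singletonD subsetD)
qed

lemma sum_weights_less:
  assumes "finite I" "inj_on u I" "\<And>i. i \<in> I \<Longrightarrow> m i \<le> dim (opB.gker (u i))"
  shows "sum m I < d'"
  using opB.sum_dim_gker_le[OF assms] dim_less by simp

text \<open>Inversion exchanges the points k and k + 1 of the orbit if x^2 q^(4k+2) = 1, and fixes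
  the point k + 1 if x^2 q^(4k+4) = 1. Away from such folds \<open>two_step\<close> applies.\<close>

lemma two_orbit:
  assumes "x \<noteq> 0" "two (jouk (x * q ^ (2 * i)))"
    and "\<And>k. i \<le> k \<Longrightarrow> k < j \<Longrightarrow> x\<^sup>2 * q ^ (4 * k + 2) \<noteq> 1 \<and> x\<^sup>2 * q ^ (4 * k + 4) \<noteq> 1"
    and "i \<le> j"
  shows "two (jouk (x * q ^ (2 * j)))"
  using assms(4,3)
proof (induction rule: dec_induct)
  case base
  then show ?case using assms(2) by simp
next
  case (step k)
  let ?y = "x * q ^ (2 * k)"
  have eq: "?y * q\<^sup>2 = x * q ^ (2 * Suc k)"
    by (simp add: power2_eq_square mult_ac)
  have y: "?y \<noteq> 0"
    using assms(1) q_nonzero by simp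
  have sq: "?y\<^sup>2 = x\<^sup>2 * q ^ (4 * k)"
    by (simp add: power_mult_distrib flip: power_mult)
  have "?y * (?y * q\<^sup>2) = x\<^sup>2 * q ^ (4 * k + 2)"
    unfolding power_add using sq by (simp add: power2_eq_square mult_ac)
  moreover have "?y \<noteq> ?y * q\<^sup>2"
    using y q2_neq_1 by simp
  ultimately have "jouk ?y \<noteq> jouk (?y * q\<^sup>2)"
    using step.prems[of k] step.hyps y q_nonzero jouk_eq_iff[of ?y "?y * q\<^sup>2"] by simp
  moreover have "?y\<^sup>2 * q ^ 4 \<noteq> 1"
    using step.prems[of k] step.hyps sq by (simp add: power_add mult.assoc)
  ultimately show ?case
    using two_step[OF y] step by (simp add: eq)
qed

text \<open>Inversion sends the index i to -i modulo d', so 0, ..., d' div 2 represent the orbit. In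
  \<open>?m\<close> the fixed points i = 0 and 2i = d' count once and all others twice, which
  recovers the d' points of the orbit.\<close>

lemma no_good_square_1:
  assumes "x\<^sup>2 = 1" "v \<noteq> 0" "opB.shift (jouk x) v = 0"
  shows False
proof -
  have x: "x \<noteq> 0"
    using assms(1) by auto
  let ?u = "\<lambda>i. jouk (x * q ^ (2 * i))"
  let ?e = "d' div 2"
  let ?m = "\<lambda>i. if i = 0 \<or> 2 * i = d' then 1 else 2 :: nat"
  have two: "two (?u i)" if "1 \<le> i" "2 * i < d'" for i
  proof (rule two_orbit[OF x _ _ that(1)])
    show "two (?u 1)"
      using two_of_square_1[OF assms] by simp
    fix k assume "1 \<le> k" "k < i"
    then have "q ^ (2 * (2 * k + 1)) \<noteq> 1" "q ^ (2 * (2 * k + 2)) \<noteq> 1"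
      using that by (intro q_pow_neq_1; linarith)+
    moreover have "2 * (2 * k + 1) = 4 * k + 2" "2 * (2 * k + 2) = 4 * k + 4"
      by simp_all
    ultimately show "x\<^sup>2 * q ^ (4 * k + 2) \<noteq> 1 \<and> x\<^sup>2 * q ^ (4 * k + 4) \<noteq> 1"
      by (simp only: assms(1) mult_1_left not_False_eq_True simp_thms)
  qed
  have ne: "?u i \<noteq> ?u j" if "i < j" "j \<le> ?e" for i j
  proof -
    have "x * q ^ (2 * i) * (x * q ^ (2 * j)) = x\<^sup>2 * q ^ (2 * (i + j))"
      by (simp add: power2_eq_square power_add distrib_left mult_ac)
    moreover have "q ^ (2 * (i + j)) \<noteq> 1"
      using that by (intro q_pow_neq_1) linarith+
    moreover have "q ^ (2 * i) \<noteq> q ^ (2 * j)"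
      using that by (intro q_pow_eq_iff) linarith+
    ultimately show ?thesis
      using x q_nonzero assms(1) jouk_eq_iff[of "x * q ^ (2 * i)" "x * q ^ (2 * j)"] by simp
  qed
  have "inj_on ?u {..?e}"
    by (rule linorder_inj_onI) (use ne in auto)
  moreover have "?m i \<le> dim (opB.gker (?u i))" if "i \<in> {..?e}" for i
  proof (cases "i = 0 \<or> 2 * i = d'")
    case True
    then show ?thesis
      using eigenvector_orbit[OF x assms(2,3), of i] dim_gker_ge_1 by auto
  next
    case False
    then have "1 \<le> i" "2 * i < d'"
      using that by auto
    then show ?thesis
      using False dim_gker_ge_2[OF two[of i]] by simp
  qed
  ultimately have "sum ?m {..?e} < d'"
    by (intro sum_weights_less[of _ ?u]) auto
  moreover have "sum ?m {..?e} = d'"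
  proof (cases "even d'")
    case True
    then have I: "{..?e} = insert 0 (insert ?e {1..<?e})" and m: "?m ?e = 1"
      using d'_ge_3 by auto
    have "sum ?m {1..<?e} = (\<Sum>i\<in>{1..<?e}. 2)"
      by (rule sum.cong) auto
    then show ?thesis
      unfolding I using True d'_ge_3 m by (subst sum.insert; simp)+ presburger
  next
    case False
    then have I: "{..?e} = insert 0 {1..?e}"
      using d'_ge_3 by auto
    have "sum ?m {1..?e} = (\<Sum>i\<in>{1..?e}. 2)"
      by (rule sum.cong) (use False in auto)
    then show ?thesis
      unfolding I using False d'_ge_3 by (subst sum.insert; simp) presburger
  qed
  ultimately show False
    by simp
qed

text \<open>Inversion sends the index i to -1-i modulo d', without fixed points as d' is even. The
  d' div 2 remaining values all count twice, starting from \<open>two_of_square_q2\<close>.\<close>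

lemma no_good_square_q2:
  assumes "x\<^sup>2 = q\<^sup>2" "even d'" "v \<noteq> 0" "opB.shift (jouk x) v = 0"
  shows False
proof -
  have x: "x \<noteq> 0"
    using assms(1) q_nonzero by auto
  let ?u = "\<lambda>i. jouk (x * q ^ (2 * i))"
  let ?e = "d' div 2"
  have two: "two (?u i)" if "i < ?e" for i
  proof (rule two_orbit[OF x, of 0])
    show "two (?u 0)"
      using two_of_square_q2[OF assms(1,3,4)] by simp
    fix k assume "k < i"
    moreover have "2 * k + 3 \<noteq> d'"
      using assms(2) by auto
    ultimately show "x\<^sup>2 * q ^ (4 * k + 2) \<noteq> 1 \<and> x\<^sup>2 * q ^ (4 * k + 4) \<noteq> 1"
      using q_pow_neq_1[of "2 * k + 2"] q_pow_neq_1[of "2 * k + 3"] that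
      unfolding assms(1) by (simp flip: power_add add: algebra_simps)
  qed simp
  have ne: "?u i \<noteq> ?u j" if "i < j" "j < ?e" for i j
  proof -
    have "x * q ^ (2 * i) * (x * q ^ (2 * j)) = x\<^sup>2 * q ^ (2 * (i + j))"
      by (simp add: power2_eq_square power_add distrib_left mult_ac)
    also have "\<dots> = q ^ (2 * (1 + i + j))"
      unfolding assms(1) by (simp add: power_add distrib_left mult_ac power2_eq_square)
    also have "\<dots> \<noteq> 1"
      using that by (intro q_pow_neq_1) linarith+
    finally have "x * q ^ (2 * i) * (x * q ^ (2 * j)) \<noteq> 1" .
    moreover have "q ^ (2 * i) \<noteq> q ^ (2 * j)"
      using that by (intro q_pow_eq_iff) linarith+
    ultimately show ?thesis
      using x q_nonzero jouk_eq_iff[of "x * q ^ (2 * i)" "x * q ^ (2 * j)"] by simp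
  qed
  have "inj_on ?u {..<?e}"
    by (rule linorder_inj_onI) (use ne in auto)
  then have "(\<Sum>i<?e. 2) < d'"
    by (intro sum_weights_less[of _ ?u] dim_gker_ge_2 two) auto
  then show False
    using assms(2) by simp
qed

end

theorem good_exists: "\<exists>x v. good x v"
proof (rule ccontr)
  assume "\<nexists>x v. good x v"
  then have no: "\<And>x v. \<not> good x v"
    by blast
  have "fin_dim (*s)"
    using finite_Basis span_Basis by (auto simp: fin_dim_def)
  then obtain v r where "v \<noteq> 0" "B v = r *s v"
    using eigenvector_exists[OF opB.lin_op_axioms _ nontrivial] by blast
  moreover obtain x where x: "x \<noteq> 0" "jouk x = r"
    using jouk_surj .
  ultimately have v: "v \<noteq> 0" "opB.shift (jouk x) v = 0"
    by (simp_all add: opB.shift_eq_0_iff)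
  note orbit = eigenvector_orbit[OF no x(1) v]
  have "\<not> inj_on (\<lambda>i. jouk (x * q ^ (2 * i))) {..<d'}"
  proof
    assume inj: "inj_on (\<lambda>i. jouk (x * q ^ (2 * i))) {..<d'}"
    have "(\<Sum>i<d'. 1) < d'"
      by (rule sum_weights_less[OF no _ inj]) (use orbit dim_gker_ge_1[OF no] in auto)
    then show False
      by simp
  qed
  then obtain i j where ij: "i < j" "j < d'" "jouk (x * q ^ (2 * i)) = jouk (x * q ^ (2 * j))"
    unfolding inj_on_def Ball_def lessThan_iff by (metis nat_neq_iff)
  moreover have "q ^ (2 * i) \<noteq> q ^ (2 * j)"
    using ij by (intro q_pow_eq_iff) auto
  ultimately have "x * q ^ (2 * i) * (x * q ^ (2 * j)) = 1"
    using x q_nonzero jouk_eq_iff[of "x * q ^ (2 * i)" "x * q ^ (2 * j)"] by simp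
  then have x_sq: "x\<^sup>2 * q ^ (2 * (i + j)) = 1"
    by (simp add: power2_eq_square power_add distrib_left mult_ac)
  \<comment> \<open>Recentring the orbit at its point t reduces this to the case x^2 = 1.\<close>
  have even: False if "x\<^sup>2 * q ^ (2 * (2 * t)) = 1" for t
  proof -
    obtain w where "w \<noteq> 0" "opB.shift (jouk (x * q ^ (2 * t))) w = 0"
      using orbit by blast
    moreover have "(x * q ^ (2 * t))\<^sup>2 = 1"
      using that by (simp add: power_mult_distrib flip: power_mult)
    ultimately show False
      using no_good_square_1[OF no] by blast
  qed
  show False
  proof (cases "even (i + j)")
    case True
    then show False
      using even x_sq by (metis evenE)
  next
    case odd: False
    show False
    proof (cases "even d'")
      case True
      obtain t where t: "i + j = 2 * t + 1"
        using odd oddE by blast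
      obtain w where "w \<noteq> 0" "opB.shift (jouk (x * q ^ (2 * (t + 1)))) w = 0"
        using orbit by blast
      moreover have "(x * q ^ (2 * (t + 1)))\<^sup>2 = x\<^sup>2 * q ^ (2 * (i + j)) * q\<^sup>2"
        unfolding t power_mult_distrib mult.assoc by (simp add: algebra_simps flip: power_mult power_add)
      ultimately show False
        using no_good_square_q2[OF no _ True] x_sq by simp
    next
      case False
      \<comment> \<open>As q^(2d') = 1, the odd number d' may be added to i + j, which changes its
        parity.\<close>
      with odd obtain t where t: "i + j + d' = 2 * t"
        by (metis evenE odd_even_add)
      have "x\<^sup>2 * q ^ (2 * (i + j + d')) = x\<^sup>2 * q ^ (2 * (i + j)) * q ^ (2 * d')"
        by (simp add: power_add distrib_left mult_ac)
      then have "x\<^sup>2 * q ^ (2 * (2 * t)) = 1"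
        unfolding t x_sq q_pow by simp
      then show False
        by (rule even)
    qed
  qed
qed

end

section \<open>The recurrence for the split sequence\<close>

lemma vth_eq_jouk:
  assumes "q \<noteq> 0" "lam \<noteq> 0"
  shows "vth q a lam i = jouk (a * q ^ (2 * i) / lam)"
proof -
  have 1: "q powi (2 * int i) = q ^ (2 * i)"
    using power_int_of_nat[of q "2 * i"] by simp
  moreover have "q powi (- 2 * int i) = inverse (q ^ (2 * i))"
    using power_int_minus[of q "2 * int i"] 1 by simp
  ultimately show ?thesis
    unfolding vth_def jouk_def by (simp add: divide_inverse mult_ac)
qed

lemma vphi_conv:
  assumes "q \<noteq> 0"
  shows "vphi q a b c lam i = inverse a * inverse b * lam * q * (q ^ i - inverse (q ^ i))
     * (q ^ i / (lam * q) - lam * q / q ^ i) * (inverse (q ^ i) - a * b * c * q ^ i / (lam * q))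
     * (inverse (q ^ i) - a * b * q ^ i / (c * lam * q))"
  using assms by (simp add: vphi_def power_int_diff power_int_minus divide_inverse mult_ac)

text \<open>As a Laurent polynomial in X, \<open>vphi\<close> turns the recurrence into a rational
  identity; c enters only through \<open>jouk c\<close>.\<close>

lemma vphi_expand:
  assumes "q \<noteq> 0" "a \<noteq> 0" "b \<noteq> 0" "c \<noteq> 0" "lam \<noteq> 0" "X = q ^ (2 * i)"
  shows "vphi q a b c lam i = a * b / (lam * q)\<^sup>2 * X\<^sup>2
     - (jouk c / (lam * q) + (1 + (lam * q)\<^sup>2) * a * b / (lam * q)\<^sup>2) * X
     + (a * b + 1 / (a * b) + jouk c * jouk (lam * q))
     - ((1 + (lam * q)\<^sup>2) / (a * b) + lam * q * jouk c) / X
     + (lam * q)\<^sup>2 / (a * b) / X\<^sup>2"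
proof -
  have X: "X = (q ^ i)\<^sup>2"
    by (simp add: assms(6) power_mult mult.commute flip: power_mult)
  have nz: "q ^ i \<noteq> 0"
    using assms(1) by simp
  show ?thesis
    unfolding vphi_conv[OF assms(1)] X jouk_def using assms(1-5) nz
    by (simp add: field_simps power2_eq_square)
qed

text \<open>The left side has the shape of that in \<open>phi_recurrence\<close>, so subtracting the
  two cancels all terms in theta.\<close>

lemma vphi_recurrence:
  assumes "q \<noteq> 0" "a \<noteq> 0" "b \<noteq> 0" "c \<noteq> 0" "lam \<noteq> 0"
  defines "f \<equiv> vphi q a b c lam" and "s \<equiv> vth q a lam" and "t \<equiv> vth q b lam"
  shows "f i - jouk (q\<^sup>2) * f (i + 1) + f (i + 2) + t i * (s i + s (i + 1))
      - jouk (q\<^sup>2) * (s i * t i + s (i + 1) * t (i + 1)) + (s i + s (i + 1)) * t (i + 1)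
    = - (q - inverse q)\<^sup>2 * vgamma q a b c lam"
proof -
  define X where "X = q ^ (2 * i)"
  have X: "q\<^sup>2 * X = q ^ (2 * (i + 1))" "q ^ 4 * X = q ^ (2 * (i + 2))" "X \<noteq> 0"
    using assms(1) by (simp_all add: X_def power4_eq_xxxx power2_eq_square mult_ac)
  have s: "s i = jouk (a * X / lam)" "s (i + 1) = jouk (a * (q\<^sup>2 * X) / lam)"
    and t: "t i = jouk (b * X / lam)" "t (i + 1) = jouk (b * (q\<^sup>2 * X) / lam)"
    using assms(1,5) unfolding s_def t_def X by (simp_all only: vth_eq_jouk X_def not_False_eq_True)
  note e = vphi_expand[OF assms(1-5)]
  show ?thesis
    unfolding f_def e[OF X_def] e[OF X(1)] e[OF X(2)] s t vgamma_def jouk_def using assms(1-5) X(3)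
    by (simp add: divide_simps) algebra
qed


text \<open>The constant e and the two initial zeros determine \<delta>, so it is e /
  \<open>?K\<close> times \<open>?s\<close>. At n + 1, \<open>?s\<close> vanishes only if q^(2n) = 1
  or q^(2(n+1)) = 1; hence the third zero forces e = 0.\<close>

lemma vphi_recurrence_unique:
  fixes q e :: "'a::field" and \<delta> :: "nat \<Rightarrow> 'a"
  assumes q: "q \<noteq> 0" "q ^ 4 \<noteq> 1" and n: "0 < n" "q ^ (2 * n) \<noteq> 1" "q ^ (2 * (n + 1)) \<noteq> 1"
    and \<delta>: "\<delta> 0 = 0" "\<delta> 1 = 0" "\<delta> (Suc n) = 0"
    and rec: "\<And>i. i < n \<Longrightarrow> \<delta> i - jouk (q\<^sup>2) * \<delta> (i + 1) + \<delta> (i + 2) = e"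
  shows "e = 0" "\<And>i. i \<le> Suc n \<Longrightarrow> \<delta> i = 0"
proof -
  \<comment> \<open>\<open>?s\<close> solves the recurrence with constant term \<open>?K\<close> and vanishes at 0 and 1.\<close>
  let ?K = "jouk q * (jouk (q\<^sup>2) - 2)"
  let ?s = "\<lambda>i. jouk (q ^ (2 * i) / q) - jouk q"
  have "?K = (q ^ 4 - 1) * (q\<^sup>2 - 1) / q ^ 3"
    using q(1) by (simp add: jouk_def divide_simps) algebra
  moreover have "q\<^sup>2 \<noteq> 1"
  proof
    assume "q\<^sup>2 = 1"
    then have "(q\<^sup>2)\<^sup>2 = 1"
      by simp
    with q(2) show False
      by (simp flip: power_mult)
  qed
  ultimately have K: "?K \<noteq> 0"
    using q by simp
  have s_rec: "?s (i + 2) = ?K + jouk (q\<^sup>2) * ?s (i + 1) - ?s i" for i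
  proof -
    define X where "X = q ^ (2 * i)"
    have X: "q ^ (2 * (i + 1)) = q\<^sup>2 * X" "q ^ (2 * (i + 2)) = q ^ 4 * X" "X \<noteq> 0"
      using q(1) by (simp_all add: X_def power4_eq_xxxx power2_eq_square mult_ac)
    show ?thesis
      unfolding X X_def[symmetric] jouk_def using q(1) X(3) by (simp add: divide_simps) algebra
  qed
  have main: "i \<le> n \<Longrightarrow> ?K * \<delta> i = e * ?s i \<and> ?K * \<delta> (i + 1) = e * ?s (i + 1)" for i
  proof (induction i)
    case 0
    then show ?case
      using q(1) \<delta> by (simp add: power2_eq_square) (metis inverse_eq_divide jouk_inverse)
  next
    case (Suc i)
    then have IH: "?K * \<delta> i = e * ?s i" "?K * \<delta> (i + 1) = e * ?s (i + 1)"
      by auto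
    have "\<delta> (i + 2) = e + jouk (q\<^sup>2) * \<delta> (i + 1) - \<delta> i"
      using rec[of i] Suc.prems by (simp add: algebra_simps)
    then have "?K * \<delta> (i + 2) = ?K * e + jouk (q\<^sup>2) * (?K * \<delta> (i + 1)) - ?K * \<delta> i"
      by (simp only: distrib_left right_diff_distrib mult.left_commute)
    also have "\<dots> = e * ?s (i + 2)"
      unfolding IH s_rec by (simp only: distrib_left right_diff_distrib mult_ac)
    finally show ?case
      using IH(2) by simp
  qed
  have "q ^ (2 * (n + 1)) / q \<noteq> q"
    using q(1) n(2) by (simp add: power2_eq_square)
  moreover have "q ^ (2 * (n + 1)) / q * q \<noteq> 1"
    using q(1) n(3) by (simp add: mult_ac)
  ultimately have "?s (n + 1) \<noteq> 0"
    using q(1) jouk_eq_iff[of "q ^ (2 * (n + 1)) / q" q] by simp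
  then show e: "e = 0"
    using main[of n] \<delta>(3) by simp
  show "\<delta> i = 0" if "i \<le> Suc n" for i
  proof (cases "i \<le> n")
    case True
    then show ?thesis using main[of i] K e by simp
  next
    case False
    with that have "i = Suc n" by simp
    then show ?thesis using \<delta>(3) by simp
  qed
qed

text \<open>Coordinates with respect to the independent set \<open>S \<union> T\<close> are unique,
  so a vector in both spans is supported on \<open>S \<inter> T\<close>.\<close>

lemma (in vector_space) span_Int_independent:
  assumes "independent (S \<union> T)"
  shows "span S \<inter> span T \<subseteq> span (S \<inter> T)"
proof
  fix z assume z: "z \<in> span S \<inter> span T"
  have "representation (S \<union> T) z = representation S z" "representation (S \<union> T) z = representation T z"
    using z assms by (auto intro!: representation_extend)
  then have "b \<in> S \<inter> T" if "representation (S \<union> T) z b \<noteq> 0" for b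
    using that representation_ne_zero by (metis IntI)
  then have "(\<Sum>b | representation (S \<union> T) z b \<noteq> 0. representation (S \<union> T) z b *s b) \<in> span (S \<inter> T)"
    by (intro span_sum span_scale span_base) simp
  moreover have "z \<in> span (S \<union> T)"
    using z span_mono[of S "S \<union> T"] by auto
  then have "(\<Sum>b | representation (S \<union> T) z b \<noteq> 0. representation (S \<union> T) z b *s b) = z"
    using assms by (intro sum_nonzero_representation_eq)
  ultimately show "z \<in> span (S \<inter> T)"
    by simp
qed

section \<open>The split basis\<close>

context aw_pair
begin

text \<open>Modulo the first i + 2 vectors, \<open>relA\<close> at m_i gives the diagonal entry of B
  at i + 2 as jouk (q^2) times the entry at i + 1 minus the entry at i, the recurrence of jouk (x
  q^(2i)); \<open>good\<close> supplies the entries at 0 and 1. The shifts t stay arbitrary because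
  both t = 0 and t = theta occur.\<close>

lemma krylov_triangular:
  assumes "good x v" "m 0 = v" and m: "\<And>i. m (Suc i) = A (m i) - t i *s m i"
  shows "B (m i) - jouk (x * q ^ (2 * i)) *s m i \<in> span (m ` {..<i})"
proof -
  let ?M = "\<lambda>i. span (m ` {..<i})" and ?th = "\<lambda>i. jouk (x * q ^ (2 * i))"
  have x: "x \<noteq> 0"
    using assms(1) by (simp add: good_def)
  have Am: "A (m i) = m (Suc i) + t i *s m i" for i
    by (simp add: m)
  have mM: "m i \<in> ?M j" if "i < j" for i j
    using that by (auto intro: span_base)
  have mono: "?M i \<subseteq> ?M j" if "i \<le> j" for i j
    using that by (intro span_mono image_mono) auto
  have AM: "A z \<in> ?M (Suc i)" if z: "z \<in> ?M i" for z i
  proof (rule opA.op_span_subset[OF _ subspace_span z])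
    fix y assume "y \<in> m ` {..<i}"
    then show "A y \<in> ?M (Suc i)"
      by (auto simp: Am intro!: span_add span_scale mM)
  qed
  have "B (m i) - ?th i *s m i \<in> ?M i \<and> B (m (Suc i)) - ?th (Suc i) *s m (Suc i) \<in> ?M (Suc i)"
  proof (induction i)
    case 0
    obtain s where s: "B (A v) = jouk (x * q\<^sup>2) *s A v + s *s v" and v: "B v = jouk x *s v"
      using assms(1) unfolding good_def opB.shift_def by (auto simp: diff_eq_eq add.commute)
    have th: "?th 1 = jouk (x * q\<^sup>2)"
      by simp
    have "B (m 1) - ?th 1 *s m 1 = (s - t 0 * jouk x + ?th 1 * t 0) *s m 0"
      unfolding th by (simp add: m assms(2) opB.op_simps s v scale_left_distrib
          scale_left_diff_distrib scale_right_diff_distrib)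
    also have "\<dots> \<in> ?M 1"
      by (intro span_scale mM) simp
    finally show ?case
      by (simp add: assms(2) v)
  next
    case (Suc i)
    define e where "e = B (m i) - ?th i *s m i"
    define e' where "e' = B (m (Suc i)) - ?th (Suc i) *s m (Suc i)"
    let ?S = "?M (Suc (Suc i))"
    have e: "e \<in> ?M i" and e': "e' \<in> ?M (Suc i)"
      using Suc by (auto simp: e_def e'_def)
    have Bm: "B (m i) = ?th i *s m i + e" "B (m (Suc i)) = ?th (Suc i) *s m (Suc i) + e'"
      by (simp_all add: e_def e'_def)
    have in_S: "e \<in> ?S" "A e \<in> ?S" "A (A e) \<in> ?S" "e' \<in> ?S" "A e' \<in> ?S" "m i \<in> ?S" "m (Suc i) \<in> ?S"
      using AM AM[OF AM[OF e]] AM[OF e] AM[OF e'] e e' mM mono[of i "Suc (Suc i)"]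
        mono[of "Suc i" "Suc (Suc i)"] by auto
    have th: "?th (Suc (Suc i)) = jouk (q\<^sup>2) * ?th (Suc i) - ?th i"
      using x q_nonzero jouk_mult[of "x * q ^ (2 * Suc i)" "q\<^sup>2"]
      by (simp add: power2_eq_square mult_ac)
    have "B (A (A (m i))) = g *s A (m i) + hA *s m i - (q\<^sup>2 - inverse (q\<^sup>2))\<^sup>2 *s B (m i)
        + jouk (q\<^sup>2) *s A (B (A (m i))) - A (A (B (m i)))"
      using relA[of "m i"] by (simp add: algebra_simps)
    also have "B (A (A (m i))) = B (m (Suc (Suc i))) + (t (Suc i) + t i) *s B (m (Suc i)) + (t i * t i) *s B (m i)"
      by (simp add: Am opA.op_simps opB.op_simps scale_right_distrib scale_left_distrib)
    finally have "B (m (Suc (Suc i))) = g *s A (m i) + hA *s m i - (q\<^sup>2 - inverse (q\<^sup>2))\<^sup>2 *s B (m i)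
        + jouk (q\<^sup>2) *s A (B (A (m i))) - A (A (B (m i)))
        - ((t (Suc i) + t i) *s B (m (Suc i)) + (t i * t i) *s B (m i))"
      by (simp add: algebra_simps)
    also have "jouk (q\<^sup>2) *s A (B (A (m i))) = (jouk (q\<^sup>2) * ?th (Suc i)) *s m (Suc (Suc i))
        + jouk (q\<^sup>2) *s ((?th (Suc i) * t (Suc i)) *s m (Suc i) + A e' + t i *s A (B (m i)))"
      by (simp add: Am Bm opA.op_simps opB.op_simps scale_right_distrib)
    also have "A (A (B (m i))) = ?th i *s m (Suc (Suc i))
        + ?th i *s ((t (Suc i) + t i) *s m (Suc i) + (t i * t i) *s m i) + A (A e)"
      by (simp add: Am Bm opA.op_simps scale_right_distrib scale_left_distrib)
    finally have "B (m (Suc (Suc i))) - ?th (Suc (Suc i)) *s m (Suc (Suc i)) =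
        g *s A (m i) + hA *s m i - (q\<^sup>2 - inverse (q\<^sup>2))\<^sup>2 *s B (m i)
        + jouk (q\<^sup>2) *s ((?th (Suc i) * t (Suc i)) *s m (Suc i) + A e' + t i *s A (B (m i)))
        - (?th i *s ((t (Suc i) + t i) *s m (Suc i) + (t i * t i) *s m i) + A (A e))
        - ((t (Suc i) + t i) *s B (m (Suc i)) + (t i * t i) *s B (m i))"
      unfolding th scale_left_diff_distrib by (simp add: diff_diff_eq add_ac)
    also have "\<dots> \<in> ?S"
      unfolding Bm opA.op_add opA.op_scale Am by (intro span_add span_diff span_scale in_S)
    finally show ?case
      using Suc by simp
  qed
  then show ?thesis by simp
qed

text \<open>At the first N with m_N in the span of its predecessors, that span is invariant under A,
  and under B by triangularity. Irreducibility makes it the whole space, so N is the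
  dimension.\<close>

lemma krylov_span:
  assumes "good x v" "m 0 = v" and m: "\<And>i. m (Suc i) = A (m i) - t i *s m i"
  shows "span (m ` {..<dim (UNIV :: 'v set)}) = UNIV"
proof -
  let ?M = "\<lambda>i. span (m ` {..<i})"
  have dim_M: "dim (?M k) = k" if "\<And>j. j < k \<Longrightarrow> m j \<notin> ?M j" for k
    using that
  proof (induction k)
    case (Suc k)
    then show ?case
      by (simp add: lessThan_Suc dim_insert)
  qed simp
  have "\<exists>N. m N \<in> ?M N"
  proof (rule ccontr)
    assume "\<nexists>N. m N \<in> ?M N"
    then have "dim (?M (Suc (dim UNIV))) = Suc (dim UNIV)"
      by (intro dim_M) blast
    then show False
      using dim_subset[of "?M (Suc (dim UNIV))" UNIV] by simp
  qed
  define N where "N = (LEAST N. m N \<in> ?M N)"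
  have N: "m N \<in> ?M N"
    unfolding N_def by (rule LeastI_ex) fact
  have N_least: "m j \<notin> ?M j" if "j < N" for j
    using that unfolding N_def by (rule not_less_Least)
  have v: "v \<noteq> 0"
    using assms(1) by (simp add: good_def)
  then have "N \<noteq> 0"
    using N assms(2) by (cases "N = 0") auto
  then have "v \<in> ?M N"
    using assms(2) by (auto intro!: span_base)
  have "A y \<in> ?M N" if y: "y \<in> m ` {..<N}" for y
  proof -
    obtain j where j: "j < N" "y = m j"
      using y by auto
    then have "m j \<in> ?M N" "m (Suc j) \<in> ?M N"
      using N by (cases "Suc j = N"; auto intro: span_base)+
    moreover have "A y = m (Suc j) + t j *s m j"
      by (simp add: m j)
    ultimately show ?thesis
      by (simp add: span_add span_scale)
  qed
  then have "A ` ?M N \<subseteq> ?M N"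
    using opA.op_span_subset subspace_span by blast
  moreover have "B y \<in> ?M N" if y: "y \<in> m ` {..<N}" for y
  proof -
    obtain j where j: "j < N" "y = m j"
      using y by auto
    then have "m j \<in> ?M N"
      by (auto intro: span_base)
    moreover have "B (m j) - jouk (x * q ^ (2 * j)) *s m j \<in> ?M N"
      using krylov_triangular[OF assms(1,2) m, of j] span_mono[of "m ` {..<j}" "m ` {..<N}"]
        image_mono[of "{..<j}" "{..<N}" m] j(1) by auto
    ultimately show ?thesis
      using span_add[OF _ span_scale] j(2) by (metis diff_add_cancel)
  qed
  then have "B ` ?M N \<subseteq> ?M N"
    using opB.op_span_subset subspace_span by blast
  ultimately have M: "?M N = UNIV"
    using irred[of "?M N"] \<open>v \<in> ?M N\<close> v by auto
  have "dim (?M N) = N"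
    by (rule dim_M) (rule N_least)
  then show ?thesis
    using M by metis
qed

end

lemma (in vector_space) coordinate_map:
  fixes m :: "nat \<Rightarrow> 'b"
  assumes indep: "independent (m ` {..n})" and inj: "inj_on m {..n}" and span: "span (m ` {..n}) = UNIV"
  obtains T :: "'b \<Rightarrow> nat \<Rightarrow> 'a" where "bij_betw T UNIV (Vn_space n)"
    and "\<And>x y. T (x + y) = (\<lambda>j. T x j + T y j)"
    and "\<And>c x. T (scale c x) = (\<lambda>j. c * T x j)"
    and "\<And>i. i \<le> n \<Longrightarrow> T (m i) = (\<lambda>j. if j = i then 1 else 0)"
proof -
  let ?R = "representation (m ` {..n})"
  define T :: "'b \<Rightarrow> nat \<Rightarrow> 'a" where "T x = (\<lambda>j. if j \<le> n then ?R x (m j) else 0)" for x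
  have add: "T (x + y) = (\<lambda>j. T x j + T y j)" for x y
    using indep span by (auto simp: T_def representation_add)
  have scale: "T (scale c x) = (\<lambda>j. c * T x j)" for c x
    using indep span by (auto simp: T_def representation_scale)
  have basis: "T (m i) = (\<lambda>j. if j = i then 1 else 0)" if "i \<le> n" for i
    using indep inj that by (auto simp: T_def representation_basis inj_on_eq_iff)
  have T_sum: "T (\<Sum>i\<in>I. f i *s m i) j = (\<Sum>i\<in>I. f i * T (m i) j)" for f I j
  proof -
    have "T 0 = (\<lambda>_. 0)"
      using scale[of 0 0] by simp
    then show ?thesis
      by (induction I rule: infinite_finite_induct) (simp_all add: add scale)
  qed
  let ?L = "\<lambda>f. \<Sum>i\<le>n. f i *s m i"
  have "bij_betw T UNIV (Vn_space n)"
  proof (rule bij_betw_byWitness[where f' = ?L])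
    have "?L (T x) = (\<Sum>b\<in>m ` {..n}. ?R x b *s b)" for x
      using inj by (simp add: sum.reindex T_def)
    also have "\<dots> x = x" for x
      using indep span by (intro sum_representation_eq) auto
    finally show "\<forall>x\<in>UNIV. ?L (T x) = x"
      by blast
    show "\<forall>f\<in>Vn_space n. T (?L f) = f"
    proof (intro ballI ext)
      fix f :: "nat \<Rightarrow> 'a" and j assume f: "f \<in> Vn_space n"
      have "T (?L f) j = (\<Sum>i\<le>n. if i = j then f i else 0)"
        unfolding T_sum by (rule sum.cong) (auto simp: basis)
      then show "T (?L f) j = f j"
        using f by (auto simp: Vn_space_def)
    qed
  qed (auto simp: T_def Vn_space_def)
  with add scale basis that show ?thesis
    by blast
qed

context aw_pair
begin

lemma split_basis:
  obtains a b n m \<phi> where "a \<noteq> 0" "b \<noteq> 0" "Suc n = dim (UNIV :: 'v set)"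
    and "independent (m ` {..n})" "inj_on m {..n}" "span (m ` {..n}) = UNIV"
    and "\<And>i. A (m i) = vth q a (q ^ n) i *s m i + m (Suc i)" "m (Suc n) = 0"
    and "\<And>i. i \<le> n \<Longrightarrow> B (m i) = vth q b (q ^ n) i *s m i + \<phi> i *s m (i - 1)"
    and "\<phi> 0 = 0" "\<phi> (Suc n) = 0"
proof -
  interpret swap: aw_pair scale Basis B A q g hB hA d'
    by (rule aw_pair_swap)
  obtain y v where v: "good y v"
    using good_exists by blast
  obtain x w where w: "swap.good x w"
    using swap.good_exists by blast
  have xy: "x \<noteq> 0" "y \<noteq> 0"
    using v w by (simp_all add: good_def swap.good_def)
  have "dim (UNIV :: 'v set) \<noteq> 0"
    using nontrivial by (auto simp: dim_eq_0 simp del: dim_UNIV)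
  then obtain n where n: "dim (UNIV :: 'v set) = Suc n"
    using not0_implies_Suc by blast
  \<comment> \<open>With these, \<open>vth q b (q ^ n)\<close> lists the diagonal entries of B on
    the flag of v, and \<open>vth q a (q ^ n)\<close> those of A on the flag of w from the top down.
    Hence A - theta_i takes \<open>?U (Suc n - i)\<close> into \<open>?U (n - i)\<close>, which ends
    in m_(n+1) = 0.\<close>
  define a where "a = inverse (x * q ^ n)"
  define b where "b = y * q ^ n"
  have ab: "a \<noteq> 0" "b \<noteq> 0"
    using xy q_nonzero by (simp_all add: a_def b_def)
  define \<theta> where "\<theta> = vth q a (q ^ n)"
  define \<theta>' where "\<theta>' = vth q b (q ^ n)"
  have \<theta>: "\<theta> i = jouk (x * q ^ (2 * (n - i)))" if "i \<le> n" for i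
  proof -
    have "n + n = 2 * i + 2 * (n - i)"
      using that by simp
    then have "q ^ n * q ^ n = q ^ (2 * i) * q ^ (2 * (n - i))"
      by (metis power_add)
    then have "q ^ (2 * i) * (x * q ^ (2 * (n - i))) = x * q ^ n * q ^ n"
      by (simp add: mult_ac)
    then have "a * q ^ (2 * i) / q ^ n = inverse (x * q ^ (2 * (n - i)))"
      using xy q_nonzero by (simp add: a_def divide_simps mult_ac)
    then have "\<theta> i = jouk (inverse (x * q ^ (2 * (n - i))))"
      using q_nonzero by (simp only: \<theta>_def vth_eq_jouk power_eq_0_iff simp_thms)
    then show ?thesis
      by (simp only: jouk_inverse)
  qed
  have \<theta>': "\<theta>' i = jouk (y * q ^ (2 * i))" for i
    using q_nonzero by (simp add: \<theta>'_def vth_eq_jouk b_def)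
  define m where "m = rec_nat v (\<lambda>i z. A z - \<theta> i *s z)"
  have m: "m 0 = v" "m (Suc i) = A (m i) - \<theta> i *s m i" for i
    by (simp_all add: m_def)
  \<comment> \<open>B maps \<open>?U k\<close> into \<open>?U (Suc k)\<close>, and the flag is triangular for A; the vector m i lies in
    \<open>?U (Suc n - i)\<close>, which together with the flag spanned by the m i confines B (m i).\<close>
  let ?U = "\<lambda>k. span ((\<lambda>j. (B ^^ j) w) ` {..<k})"
  have U_step: "A ((B ^^ i) w) - jouk (x * q ^ (2 * i)) *s (B ^^ i) w \<in> ?U i" for i
    using swap.krylov_triangular[where m = "\<lambda>j. (B ^^ j) w" and t = "\<lambda>_. 0", OF w] by simp
  have U_UNIV: "?U (Suc n) = UNIV"
    using swap.krylov_span[where m = "\<lambda>j. (B ^^ j) w" and t = "\<lambda>_. 0", OF w] n by simp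
  have in_U: "(B ^^ j) w \<in> ?U k" if "j < k" for j k
    using that by (intro span_base) blast
  have mono_U: "?U j \<subseteq> ?U k" if "j \<le> k" for j k
    using that by (intro span_mono image_mono) auto
  have U_B: "B z \<in> ?U (Suc k)" if z: "z \<in> ?U k" for z k
  proof (rule opB.op_span_subset[OF _ subspace_span z])
    fix u assume "u \<in> (\<lambda>j. (B ^^ j) w) ` {..<k}"
    then obtain j where "j < k" "u = (B ^^ j) w" by blast
    then show "B u \<in> ?U (Suc k)"
      using in_U[of "Suc j" "Suc k"] by simp
  qed
  have U_A: "opA.shift (jouk (x * q ^ (2 * k))) z \<in> ?U k" if z: "z \<in> ?U (Suc k)" for z k
  proof (rule lin_op.op_span_subset[OF opA.lin_op_shift _ subspace_span z])
    fix u assume "u \<in> (\<lambda>j. (B ^^ j) w) ` {..<Suc k}"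
    then obtain j where j: "j < Suc k" "u = (B ^^ j) w" by blast
    show "opA.shift (jouk (x * q ^ (2 * k))) u \<in> ?U k"
    proof (cases "j = k")
      case True
      then show ?thesis
        using U_step[of k] j by (simp add: opA.shift_def)
    next
      case False
      then have "u \<in> ?U k"
        using in_U j by auto
      moreover have "A u - jouk (x * q ^ (2 * j)) *s u \<in> ?U k"
        using U_step[of j] mono_U[of j k] j False by auto
      ultimately have "(A u - jouk (x * q ^ (2 * j)) *s u) + (jouk (x * q ^ (2 * j)) - jouk (x * q ^ (2 * k))) *s u \<in> ?U k"
        by (intro span_add span_scale)
      then show ?thesis
        by (simp add: opA.shift_def scale_left_diff_distrib)
    qed
  qed
  have m_U: "i \<le> Suc n \<Longrightarrow> m i \<in> ?U (Suc n - i)" for i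
  proof (induction i)
    case 0
    then show ?case using U_UNIV by simp
  next
    case (Suc i)
    then have "m i \<in> ?U (Suc (n - i))"
      by (simp add: Suc_diff_le)
    then show ?case
      using U_A[of "m i" "n - i"] Suc.prems \<theta>[of i] by (simp add: m opA.shift_def)
  qed
  have tri: "B (m i) - \<theta>' i *s m i \<in> span (m ` {..<i})" for i
    using krylov_triangular[where m = m and t = \<theta>, OF v m(1)] m(2) \<theta>' by simp
  have span_m: "span (m ` {..n}) = UNIV"
    using krylov_span[where m = m and t = \<theta>, OF v m(1)] m(2) n by (simp add: lessThan_Suc_atMost)
  then have "Suc n \<le> card (m ` {..n})"
    using dim_le_card[of UNIV "m ` {..n}"] n by simp
  then have card_m: "card (m ` {..n}) = card {..n}"
    using card_image_le[of "{..n}" m] by simp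
  then have inj: "inj_on m {..n}"
    by (intro eq_card_imp_inj_on) auto
  have indep: "independent (m ` {..n})"
    using span_m n card_m by (intro card_le_dim_spanning[of _ UNIV]) auto
  have "\<exists>s. B (m i) - \<theta>' i *s m i = s *s m (i - 1)" if i: "0 < i" "i \<le> n" for i
  proof -
    let ?T = "m ` {i - 1..n}"
    have T_sub: "?T \<subseteq> ?U (Suc (Suc n - i))"
    proof safe
      fix j assume j: "j \<in> {i - 1..n}"
      then have "Suc n - j \<le> Suc (Suc n - i)"
        by auto
      then show "m j \<in> ?U (Suc (Suc n - i))"
        using m_U[of j] mono_U j by fastforce
    qed
    have "independent ?T"
      by (rule independent_mono[OF indep]) auto
    moreover have "card ?T = Suc (Suc n - i)"
      using inj_on_subset[OF inj, of "{i - 1..n}"] i by (simp add: card_image Suc_diff_le)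
    moreover have "dim (?U (Suc (Suc n - i))) \<le> Suc (Suc n - i)"
      using dim_le_card'[of "(\<lambda>j. (B ^^ j) w) ` {..<Suc (Suc n - i)}"]
        card_image_le[of "{..<Suc (Suc n - i)}" "\<lambda>j. (B ^^ j) w"] by simp
    \<comment> \<open>Both spaces have dimension n + 2 - i. The vector B m_i - theta'_i m_i thus
      lies in the spans of m_0, ..., m_(i-1) and of m_(i-1), ..., m_n, which share only the line of
      m_(i-1).\<close>
    ultimately have U_eq: "span ?T = ?U (Suc (Suc n - i))"
      using T_sub by (intro subspace_dim_equal) (auto simp: dim_eq_card_independent span_minimal subspace_span)
    have "m i \<in> ?U (Suc n - i)"
      using m_U i by simp
    then have "B (m i) - \<theta>' i *s m i \<in> ?U (Suc (Suc n - i))"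
      using U_B mono_U[of "Suc n - i" "Suc (Suc n - i)"] by (intro span_diff span_scale) auto
    then have "B (m i) - \<theta>' i *s m i \<in> span (m ` {..<i}) \<inter> span ?T"
      using tri U_eq by simp
    moreover have "independent (m ` {..<i} \<union> ?T)"
      by (rule independent_mono[OF indep]) (use i in auto)
    moreover have "m ` {..<i} \<inter> ?T = m ` ({..<i} \<inter> {i - 1..n})"
      by (rule inj_on_image_Int[OF inj, symmetric]) (use i in auto)
    moreover have "{..<i} \<inter> {i - 1..n} = {i - 1}"
      using i by auto
    ultimately have "B (m i) - \<theta>' i *s m i \<in> span {m (i - 1)}"
      using span_Int_independent[of "m ` {..<i}" ?T] by auto
    then show ?thesis
      by (auto simp: span_singleton)
  qed
  then obtain \<psi> where \<psi>: "\<And>i. 0 < i \<Longrightarrow> i \<le> n \<Longrightarrow> B (m i) - \<theta>' i *s m i = \<psi> i *s m (i - 1)"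
    by metis
  \<comment> \<open>Truncated subtraction makes m_(0-1) equal to m_0, so the value at 0 must be 0;
    the value at n + 1 closes the recurrence at its upper end.\<close>
  define \<phi> where "\<phi> i = (if i = 0 \<or> i = Suc n then 0 else \<psi> i)" for i
  show ?thesis
  proof (rule that[OF ab n[symmetric] indep inj span_m])
    show "A (m i) = vth q a (q ^ n) i *s m i + m (Suc i)" for i
      by (simp add: m \<theta>_def)
    show "m (Suc n) = 0"
      using m_U[of "Suc n"] by simp
    show "B (m i) = vth q b (q ^ n) i *s m i + \<phi> i *s m (i - 1)" if "i \<le> n" for i
      using tri[of 0] \<psi>[of i] that by (cases "i = 0") (simp_all add: \<phi>_def \<theta>'_def diff_eq_eq add.commute)
  qed (simp_all add: \<phi>_def)
qed


text \<open>Compares the coefficients of m_(i+1) in \<open>relA\<close> applied to m_i: on the right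
  only g A m_i reaches m_(i+1), with coefficient g.\<close>

lemma phi_recurrence:
  assumes indep: "independent (m ` {..n})" and inj: "inj_on m {..n}" and span: "span (m ` {..n}) = UNIV"
    and Am: "\<And>i. A (m i) = \<theta> i *s m i + m (Suc i)" and m0: "m (Suc n) = 0"
    and Bm: "\<And>i. i \<le> n \<Longrightarrow> B (m i) = \<theta>' i *s m i + \<phi> i *s m (i - 1)"
    and \<phi>: "\<phi> 0 = 0" "\<phi> (Suc n) = 0" and i: "i < n"
  shows "\<phi> i - jouk (q\<^sup>2) * \<phi> (i + 1) + \<phi> (i + 2) + \<theta>' i * (\<theta> i + \<theta> (i + 1))
      - jouk (q\<^sup>2) * (\<theta> i * \<theta>' i + \<theta> (i + 1) * \<theta>' (i + 1)) + (\<theta> i + \<theta> (i + 1)) * \<theta>' (i + 1) = g"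
proof -
  obtain T where "bij_betw T UNIV (Vn_space n)" and T: "\<And>x y. T (x + y) = (\<lambda>j. T x j + T y j)" "\<And>c x. T (c *s x) = (\<lambda>j. c * T x j)"
    "\<And>j. j \<le> n \<Longrightarrow> T (m j) = (\<lambda>k. if k = j then 1 else 0)"
    by (rule coordinate_map[OF indep inj span]) (rule that)
  define r where "r x = T x (Suc i)" for x
  have r_add: "r (x + y) = r x + r y" and r_scale: "r (c *s x) = c * r x" for x y c
    by (simp_all add: r_def T)
  have r_diff: "r (x - y) = r x - r y" for x y
    using r_add[of "x - y" y] by simp
  have r_0: "r 0 = 0"
    using r_scale[of 0 0] by simp
  have r_m: "r (m j) = (if j = Suc i then 1 else 0)" if "j \<le> Suc n" for j
    using that T(3)[of j] i m0 r_0 by (cases "j = Suc n") (auto simp: r_def)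
  \<comment> \<open>For i = n - 1 the vector m_(i+2) is zero and no basis vector;
    \<open>\<phi> (Suc n) = 0\<close> keeps the formula uniform.\<close>
  have B2: "r (B (m (Suc (Suc i)))) = \<phi> (i + 2)"
  proof (cases "Suc (Suc i) \<le> n")
    case True
    then show ?thesis
      by (simp add: Bm r_add r_scale r_m)
  next
    case False
    then have "Suc (Suc i) = Suc n"
      using i by simp
    then show ?thesis
      using \<phi>(2) r_0 by (simp add: m0 opB.op_zero)
  qed
  have r_A: "r (A (m j)) = (if j = Suc i then \<theta> (Suc i) else if j = i then 1 else 0)" if "j \<le> n" for j
    using that i by (auto simp: Am r_add r_scale r_m)
  have r_AA: "r (A (A (m j))) = (if j = Suc i then \<theta> (Suc i) * \<theta> (Suc i) else if j = i then \<theta> i + \<theta> (Suc i)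
      else if Suc j = i then 1 else 0)" if "j \<le> i" for j
    using that i by (auto simp: Am opA.op_simps r_add r_scale r_m)
  have 1: "r (A (A (B (m i)))) = \<theta>' i * (\<theta> i + \<theta> (Suc i)) + \<phi> i"
    using i \<phi>(1) by (cases i) (simp_all add: Bm opA.op_simps r_add r_scale r_AA)
  have 2: "r (A (B (A (m i)))) = \<theta> i * \<theta>' i + \<theta> (Suc i) * \<theta>' (Suc i) + \<phi> (Suc i)"
  proof -
    have "r (A (B (m i))) = \<theta>' i"
      using i \<phi>(1) by (cases i) (simp_all add: Bm opA.op_simps r_add r_scale r_A)
    moreover have "r (A (B (m (Suc i)))) = \<theta>' (Suc i) * \<theta> (Suc i) + \<phi> (Suc i)"
      using i by (simp add: Bm opA.op_simps r_add r_scale r_A)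
    ultimately show ?thesis
      by (simp add: Am[of i] opA.op_simps opB.op_simps r_add r_scale mult.commute)
  qed
  have 3: "r (B (A (A (m i)))) = (\<theta> i + \<theta> (Suc i)) * \<theta>' (Suc i) + \<phi> (i + 2)"
  proof -
    have "r (B (m i)) = 0" "r (B (m (Suc i))) = \<theta>' (Suc i)"
      using i by (simp_all add: Bm r_add r_scale r_m)
    then show ?thesis
      using B2 by (simp add: Am opA.op_simps opB.op_simps r_add r_scale distrib_right)
  qed
  have "r (B (m i)) = 0"
    using i by (simp add: Bm r_add r_scale r_m)
  then have "r (A (A (B (m i)))) - jouk (q\<^sup>2) * r (A (B (A (m i)))) + r (B (A (A (m i)))) = g"
    using arg_cong[OF relA[of "m i"], of r] i by (simp add: r_add r_diff r_scale r_A r_m)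
  then show ?thesis
    unfolding 1 2 3 by (simp add: algebra_simps)
qed

theorem normal_form:
  obtains a b c n m where "a \<noteq> 0" "b \<noteq> 0" "c \<noteq> 0" "Suc n = dim (UNIV :: 'v set)"
    and "independent (m ` {..n})" "inj_on m {..n}" "span (m ` {..n}) = UNIV"
    and "\<And>i. A (m i) = vth q a (q ^ n) i *s m i + m (Suc i)" "m (Suc n) = 0"
    and "\<And>i. i \<le> n \<Longrightarrow> B (m i) = vth q b (q ^ n) i *s m i + vphi q a b c (q ^ n) i *s m (i - 1)"
    and "g = - (q - inverse q)\<^sup>2 * vgamma q a b c (q ^ n)"
proof -
  obtain a b n m \<phi> where ab: "a \<noteq> 0" "b \<noteq> 0" and n: "Suc n = dim (UNIV :: 'v set)"
    and basis: "independent (m ` {..n})" "inj_on m {..n}" "span (m ` {..n}) = UNIV"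
    and Am: "\<And>i. A (m i) = vth q a (q ^ n) i *s m i + m (Suc i)" and m0: "m (Suc n) = 0"
    and Bm: "\<And>i. i \<le> n \<Longrightarrow> B (m i) = vth q b (q ^ n) i *s m i + \<phi> i *s m (i - 1)"
    and \<phi>: "\<phi> 0 = 0" "\<phi> (Suc n) = 0"
    by (rule split_basis) (rule that)
  have qn: "q ^ n \<noteq> 0"
    using q_nonzero by simp
  note q = q_minus_inverse_neq_0 q_plus_inverse_neq_0
  have n_less: "n + 1 < d'"
    using n dim_less by simp
  show ?thesis
  proof (cases "n = 0")
    case True
    \<comment> \<open>This solves the formula of \<open>vgamma\<close> at lam = 1 for
      \<open>jouk c\<close>.\<close>
    obtain c where c: "c \<noteq> 0" "jouk c = (- g / (q - inverse q)\<^sup>2 - (a + inverse a) * (b + inverse b)) / (q + inverse q)"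
      using jouk_surj by blast
    have "vgamma q a b c (q ^ n) = - g / (q - inverse q)\<^sup>2"
      using c(2) q(2) True by (simp add: vgamma_def jouk_def)
    then have "g = - (q - inverse q)\<^sup>2 * vgamma q a b c (q ^ n)"
      using q(1) by simp
    moreover have "vphi q a b c (q ^ n) 0 = 0"
      by (simp add: vphi_def)
    then have "\<And>i. i \<le> n \<Longrightarrow> B (m i) = vth q b (q ^ n) i *s m i + vphi q a b c (q ^ n) i *s m (i - 1)"
      using Bm \<phi>(1) True by simp
    ultimately show ?thesis
      using that[OF ab(1,2) c(1) n basis Am m0] by blast
  next
    case False
    \<comment> \<open>D collects the factors of \<open>vphi\<close> at i = 1 that are free of c. The
      rest is affine in \<open>jouk c\<close>, so every value of \<phi> 1 is reached once D is
      nonzero.\<close>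
    define D where "D = inverse a * inverse b * q ^ n * q * (q - inverse q) * (1 / q ^ n - q ^ n)"
    have "q ^ (2 * n) \<noteq> 1"
      using False n_less by (intro q_pow_neq_1) auto
    then have "1 / q ^ n - q ^ n \<noteq> 0"
      using qn by (simp add: divide_simps mult_2 power_add)
    then have D: "D \<noteq> 0"
      using ab q_nonzero q(1) by (simp add: D_def)
    have v1: "vphi q a b c (q ^ n) 1
        = D * (1 / q\<^sup>2 + (a * b / q ^ n)\<^sup>2 - a * b / (q * q ^ n) * jouk c)" if "c \<noteq> 0" for c
      unfolding vphi_conv[OF q_nonzero] D_def jouk_def using that ab q_nonzero qn
      by (simp add: field_simps power2_eq_square)
    obtain c where c: "c \<noteq> 0"
      "jouk c = (1 / q\<^sup>2 + (a * b / q ^ n)\<^sup>2 - \<phi> 1 / D) / (a * b / (q * q ^ n))"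
      using jouk_surj by blast
    have "vphi q a b c (q ^ n) 1 = \<phi> 1"
      unfolding v1[OF c(1)] c(2) using D ab q_nonzero qn by simp
    then have \<delta>1: "\<phi> 1 - vphi q a b c (q ^ n) 1 = 0"
      by simp
    have \<delta>0: "\<phi> 0 - vphi q a b c (q ^ n) 0 = 0"
      using \<phi>(1) by (simp add: vphi_def)
    \<comment> \<open>For lam = q^n the factor lam^(-1) q^(i-1) - lam q^(1-i) vanishes at i = n +
      1.\<close>
    have "vphi q a b c (q ^ n) (Suc n) = 0"
      using q_nonzero by (simp add: vphi_conv)
    then have \<delta>n: "\<phi> (Suc n) - vphi q a b c (q ^ n) (Suc n) = 0"
      using \<phi>(2) by simp
    let ?e = "g - - (q - inverse q)\<^sup>2 * vgamma q a b c (q ^ n)"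
    have "r - s - j * (r' - s') + (r'' - s'') = G - H"
      if "r - j * r' + r'' + X - Y + Z = G" "s - j * s' + s'' + X - Y + Z = H"
      for r r' r'' s s' s'' j X Y Z G H :: 'a
      unfolding that[symmetric] by (simp add: algebra_simps)
    then have rec: "\<phi> i - vphi q a b c (q ^ n) i - jouk (q\<^sup>2) * (\<phi> (i + 1) - vphi q a b c (q ^ n) (i + 1))
        + (\<phi> (i + 2) - vphi q a b c (q ^ n) (i + 2)) = ?e" if "i < n" for i
      using phi_recurrence[OF basis Am m0 Bm \<phi> that]
        vphi_recurrence[OF q_nonzero ab(1,2) c(1) qn, of i] by blast
    have qs: "q ^ (2 * n) \<noteq> 1" "q ^ (2 * (n + 1)) \<noteq> 1"
      using False n_less by (intro q_pow_neq_1; simp)+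
    note uniq = vphi_recurrence_unique[where \<delta> = "\<lambda>i. \<phi> i - vphi q a b c (q ^ n) i",
        OF q_nonzero q4_neq_1 _ qs \<delta>0 \<delta>1 \<delta>n rec]
    have "g = - (q - inverse q)\<^sup>2 * vgamma q a b c (q ^ n)"
      using uniq(1) False by (simp add: eq_neg_iff_add_eq_0)
    moreover have "\<phi> i = vphi q a b c (q ^ n) i" if "i \<le> n" for i
      using uniq(2)[of i] False that by simp
    ultimately show ?thesis
      using that[OF ab(1,2) c(1) n basis Am m0] Bm by simp
  qed
qed

end

section \<open>From the module to the pair of operators\<close>

lemma aw_irreducible_schur:
  fixes scale :: "'a::alg_closed_field \<Rightarrow> 'v::ab_group_add \<Rightarrow> 'v"
  assumes irr: "aw_irreducible q scale A B C" and fd: "fin_dim scale" and Z: "lin_op scale Z"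
    and comm: "\<And>X v. X \<in> {A, B, C} \<Longrightarrow> Z (X v) = X (Z v)"
  obtains s where "\<And>v. Z v = scale s v"
proof -
  interpret Z: lin_op scale Z by fact
  have lin: "X (scale c v) = scale c (X v)" if "X \<in> {A, B, C}" for X c v
    using irr that unfolding aw_irreducible_def aw_module_def Vector_Spaces.linear_iff by auto
  have nontriv: "(UNIV :: 'v set) \<noteq> {0}"
    using irr by (simp add: aw_irreducible_def)
  obtain u s where us: "u \<noteq> 0" "Z u = scale s u"
    using eigenvector_exists[OF Z fd nontriv] by blast
  let ?W = "{v. Z v = scale s v}"
  have "Z.subspace ?W"
    by (auto simp: Z.subspace_def Z.op_simps Z.scale_right_distrib mult.commute)
  moreover have "X ` ?W \<subseteq> ?W" if "X \<in> {A, B, C}" for X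
    using comm[OF that] lin[OF that] by auto
  ultimately have "?W = {0} \<or> ?W = UNIV"
    using irr unfolding aw_irreducible_def by blast
  then show ?thesis
    using us that by blast
qed

text \<open>Z is substituted into the central element at X, and the result is multiplied by (q^2 -
  q^(-2))^2. In Y Y X and X Y Y the factors q and q^(-1) cancel; in Y X Y they add up to q^2 +
  q^(-2).\<close>

lemma (in vector_space) askey_wilson_relation:
  assumes X: "lin_op scale X" and Y: "lin_op scale Y" and q: "q \<noteq> 0" "q\<^sup>2 - inverse q ^ 2 \<noteq> 0"
    and Z: "\<And>v. Z v = \<gamma> *s v - inverse (q\<^sup>2 - inverse q ^ 2) *s (q *s X (Y v) - inverse q *s Y (X v))"
    and cen: "X v + inverse (q\<^sup>2 - inverse q ^ 2) *s (q *s Y (Z v) - inverse q *s Z (Y v)) = \<alpha> *s v"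
  shows "Y (Y (X v)) - jouk (q\<^sup>2) *s Y (X (Y v)) + X (Y (Y v)) + (q\<^sup>2 - inverse (q\<^sup>2))\<^sup>2 *s X v
    = (- (q\<^sup>2 - inverse q ^ 2) * (q - inverse q) * \<gamma>) *s Y v + ((q\<^sup>2 - inverse q ^ 2)\<^sup>2 * \<alpha>) *s v"
proof -
  interpret X: lin_op scale X by fact
  interpret Y: lin_op scale Y by fact
  define k where "k = q\<^sup>2 - inverse q ^ 2"
  define h where "h = inverse k"
  have kh: "k * h = 1" "k \<noteq> 0"
    using q(2) by (simp_all add: k_def h_def)
  let ?YYX = "Y (Y (X v))" and ?YXY = "Y (X (Y v))" and ?XYY = "X (Y (Y v))"
  have qq: "q * inverse q = 1"
    using q(1) by simp
  have "q *s Y (Z v) - inverse q *s Z (Y v) = (\<gamma> * (q - inverse q)) *s Y v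
      - (h * (q * q + inverse q * inverse q)) *s ?YXY + (h * (q * inverse q)) *s ?YYX + (h * (q * inverse q)) *s ?XYY"
    by (simp add: Z Y.op_simps scale_right_distrib scale_right_diff_distrib scale_left_distrib
        scale_left_diff_distrib mult_ac right_diff_distrib distrib_left flip: k_def h_def)
  then have H: "\<alpha> *s v = X v + h *s ((\<gamma> * (q - inverse q)) *s Y v - h *s jouk (q\<^sup>2) *s ?YXY + h *s ?YYX + h *s ?XYY)"
    using cen[folded k_def, folded h_def] qq by (simp add: jouk_def power2_eq_square)
  have "(k * k * \<alpha>) *s v = (k * k) *s (\<alpha> *s v)"
    by simp
  also have "\<dots> = (k * k) *s X v + (k * (k * h)) *s (\<gamma> * (q - inverse q)) *s Y v
      - ((k * h) * (k * h)) *s jouk (q\<^sup>2) *s ?YXY + ((k * h) * (k * h)) *s ?YYX + ((k * h) * (k * h)) *s ?XYY"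
    unfolding H by (simp add: scale_right_distrib scale_right_diff_distrib mult_ac)
  finally have "(k * k * \<alpha>) *s v = (k * k) *s X v + (k * (\<gamma> * (q - inverse q))) *s Y v
      - jouk (q\<^sup>2) *s ?YXY + ?YYX + ?XYY"
    unfolding kh by simp
  moreover have "(q\<^sup>2 - inverse (q\<^sup>2))\<^sup>2 = k * k"
    by (simp add: k_def power2_eq_square)
  ultimately show ?thesis
    unfolding k_def[symmetric] by (simp add: power2_eq_square[of k] algebra_simps)
qed

text \<open>On both sides C is the same combination of A, B and the scalar of the third central
  element, so intertwining A and B suffices once these scalars agree. They do by the two formulas
  for g, as q^2 - q^(-2) = (q - q^(-1)) (q + q^(-1)).\<close>

lemma (in aw_pair) iso_to_Vn:
  fixes C :: "'v \<Rightarrow> 'v"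
  assumes C: "\<And>v. C v = \<gamma> *s v - inverse (q\<^sup>2 - inverse q ^ 2) *s (q *s A (B v) - inverse q *s B (A v))"
    and g: "g = - (q\<^sup>2 - inverse q ^ 2) * (q - inverse q) * \<gamma>"
  shows "\<exists>a b c n. a \<noteq> 0 \<and> b \<noteq> 0 \<and> c \<noteq> 0 \<and> n + 2 \<le> d' \<and> iso_to_Vn q scale A B C a b c n"
proof -
  obtain a b c n m where abc: "a \<noteq> 0" "b \<noteq> 0" "c \<noteq> 0" and n: "Suc n = dim (UNIV :: 'v set)"
    and indep: "independent (m ` {..n})" and inj: "inj_on m {..n}" and span: "span (m ` {..n}) = UNIV"
    and Am: "\<And>i. A (m i) = vth q a (q ^ n) i *s m i + m (Suc i)" and m0: "m (Suc n) = 0"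
    and Bm: "\<And>i. i \<le> n \<Longrightarrow> B (m i) = vth q b (q ^ n) i *s m i + vphi q a b c (q ^ n) i *s m (i - 1)"
    and g': "g = - (q - inverse q)\<^sup>2 * vgamma q a b c (q ^ n)"
    by (rule normal_form) (rule that)
  obtain T where bij: "bij_betw T UNIV (Vn_space n)"
    and T_add: "\<And>x y. T (x + y) = (\<lambda>j. T x j + T y j)"
    and T_scale: "\<And>c x. T (c *s x) = (\<lambda>j. c * T x j)"
    and T_m: "\<And>i. i \<le> n \<Longrightarrow> T (m i) = (\<lambda>j. if j = i then 1 else 0)"
    by (rule coordinate_map[OF indep inj span]) (rule that)
  have T_0: "T 0 = (\<lambda>_. 0)"
    using T_scale[of 0 0] by simp
  have T_diff: "T (x - y) = (\<lambda>j. T x j - T y j)" for x y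
    using T_add[of "x - y" y] by (auto simp: fun_eq_iff)
  have T_A: "T (A x) = Vn_A q a b c n (T x)" for x
  proof -
    have "subspace {x. T (A x) = Vn_A q a b c n (T x)}"
      unfolding subspace_def by (auto simp: opA.op_simps T_0 T_add T_scale Vn_A_def algebra_simps)
    moreover have "m ` {..n} \<subseteq> {x. T (A x) = Vn_A q a b c n (T x)}"
    proof safe
      fix i assume i: "i \<le> n"
      show "T (A (m i)) = Vn_A q a b c n (T (m i))"
      proof (cases "i = n")
        case True
        then show ?thesis
          by (auto simp: Am m0 T_0 T_add T_scale T_m Vn_A_def fun_eq_iff)
      next
        case False
        then show ?thesis
          using i by (auto simp: Am T_add T_scale T_m Vn_A_def fun_eq_iff)
      qed
    qed
    ultimately show ?thesis
      using span_minimal span by blast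
  qed
  have T_B: "T (B x) = Vn_B q a b c n (T x)" for x
  proof -
    have "subspace {x. T (B x) = Vn_B q a b c n (T x)}"
      unfolding subspace_def by (auto simp: opB.op_simps T_0 T_add T_scale Vn_B_def algebra_simps)
    moreover have "m ` {..n} \<subseteq> {x. T (B x) = Vn_B q a b c n (T x)}"
    proof safe
      fix i assume i: "i \<le> n"
      have "vphi q a b c (q ^ n) 0 = 0"
        by (simp add: vphi_def)
      then show "T (B (m i)) = Vn_B q a b c n (T (m i))"
        using i by (cases i) (auto simp: Bm T_add T_scale T_m Vn_B_def fun_eq_iff)
    qed
    ultimately show ?thesis
      using span_minimal span by blast
  qed
  note q = q_minus_inverse_neq_0 q_plus_inverse_neq_0
  have "(q - inverse q)\<^sup>2 * vgamma q a b c (q ^ n) = (q - inverse q)\<^sup>2 * ((q + inverse q) * \<gamma>)"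
    using g g' q_nonzero by (simp add: power2_eq_square algebra_simps)
  then have "vgamma q a b c (q ^ n) = (q + inverse q) * \<gamma>"
    using q(1) by simp
  then have \<gamma>: "vgamma q a b c (q ^ n) * inverse (q + inverse q) = \<gamma>"
    using q(2) by (simp add: field_simps)
  have T_C: "T (C x) = Vn_C q a b c n (T x)" for x
    unfolding C Vn_C_def \<gamma> by (simp add: T_diff T_scale T_A T_B)
  have "iso_to_Vn q scale A B C a b c n"
    unfolding iso_to_Vn_def using bij T_add T_scale T_A T_B T_C by blast
  moreover have "n + 2 \<le> d'"
    using n dim_less by simp
  ultimately show ?thesis
    using abc by blast
qed

theorem theorem1p6:
  fixes q :: "'a::alg_closed_field" and d d' :: nat
    and scale :: "'a \<Rightarrow> 'v::ab_group_add \<Rightarrow> 'v"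
    and A B C :: "'v \<Rightarrow> 'v"
  assumes d_pos: "d > 0"
    and q_root: "q ^ d = 1"
    and q_order: "\<forall>k. 0 < k \<and> k < d \<longrightarrow> q ^ k \<noteq> 1"
    and d_not: "d \<notin> {1, 2, 4}"
    and d'_def: "d' = (if odd d then d else d div 2)"
    and irr: "aw_irreducible q scale A B C"
    and fd: "fin_dim scale"
    and dim_lt: "vector_space.dim scale (UNIV :: 'v set) < d'"
  shows "\<exists>a b c n. a \<noteq> 0 \<and> b \<noteq> 0 \<and> c \<noteq> 0 \<and> n + 2 \<le> d' \<and>
           iso_to_Vn q scale A B C a b c n"
proof -
  have mod: "aw_module q scale A B C"
    using irr by (simp add: aw_irreducible_def)
  then interpret vector_space scale
    by (simp add: aw_module_def)
  have lin_opI: "lin_op scale X" if "Vector_Spaces.linear scale scale X" for X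
    using that by unfold_locales (auto simp: Vector_Spaces.linear_iff)
  interpret A: lin_op scale A
    using mod by (intro lin_opI) (simp add: aw_module_def)
  interpret B: lin_op scale B
    using mod by (intro lin_opI) (simp add: aw_module_def)
  interpret C: lin_op scale C
    using mod by (intro lin_opI) (simp add: aw_module_def)
  have cen: "aw_cen q scale X Y Z (U v) = U (aw_cen q scale X Y Z v)"
    if "(X, Y, Z) \<in> {(A, B, C), (B, C, A), (C, A, B)}" "U \<in> {A, B, C}" for X Y Z U v
  proof -
    have "aw_cen q scale X Y Z \<circ> U = U \<circ> aw_cen q scale X Y Z"
      using mod that unfolding aw_module_def by blast
    then show ?thesis
      by (metis comp_apply)
  qed
  have scalar: "\<exists>s. \<forall>v. aw_cen q scale X Y Z v = scale s v"
    if XYZ: "(X, Y, Z) \<in> {(A, B, C), (B, C, A), (C, A, B)}" for X Y Z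
  proof -
    have "lin_op scale (aw_cen q scale X Y Z)"
      by unfold_locales (use XYZ in \<open>auto simp: aw_cen_def A.op_simps B.op_simps C.op_simps
            scale_right_distrib scale_right_diff_distrib mult_ac\<close>)
    then show ?thesis
      using aw_irreducible_schur[OF irr fd _ cen[OF XYZ]] by blast
  qed
  obtain \<alpha> where \<alpha>: "\<And>v. aw_cen q scale A B C v = scale \<alpha> v"
    using scalar[of A B C] by auto
  obtain \<beta> where \<beta>: "\<And>v. aw_cen q scale B C A v = scale \<beta> v"
    using scalar[of B C A] by auto
  obtain \<gamma> where \<gamma>: "\<And>v. aw_cen q scale C A B v = scale \<gamma> v"
    using scalar[of C A B] by auto
  have q: "q \<noteq> 0"
    using q_root d_pos by (auto simp: power_0_left)
  have d': "3 \<le> d'" "q ^ (2 * d') = 1"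
  proof -
    show "3 \<le> d'"
      using d_pos d_not d'_def by (auto elim!: oddE evenE)
    show "q ^ (2 * d') = 1"
      using q_root d'_def by (cases "odd d") (auto simp: mult.commute power_mult)
  qed
  have q_pow: "q ^ (2 * i) \<noteq> 1" if "0 < i" "i < d'" for i
  proof (cases "odd d \<and> d \<le> 2 * i")
    case False
    then show ?thesis
      using q_order that d'_def by (auto split: if_splits)
  next
    case True
    then have "q ^ (2 * i) = q ^ (2 * i - d)"
      using q_root power_add[of q d "2 * i - d"] by simp
    moreover have "2 * i \<noteq> d"
      using True by auto
    then have "0 < 2 * i - d" "2 * i - d < d"
      using True that d'_def by auto
    ultimately show ?thesis
      using q_order by simp
  qed
  let ?k = "q\<^sup>2 - inverse q ^ 2"
  have "?k * q\<^sup>2 = q ^ 4 - 1"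
    using q by (simp add: field_simps flip: power_add)
  then have k: "?k \<noteq> 0"
    using q_pow[of 2] d'(1) by auto
  have C: "C v = scale \<gamma> v - scale (inverse ?k) (scale q (A (B v)) - scale (inverse q) (B (A v)))" for v
    using \<gamma>[of v] by (simp add: aw_cen_def algebra_simps)
  let ?g = "- ?k * (q - inverse q) * \<gamma>"
  obtain S where "finite S" "span S = UNIV"
    using fd by (auto simp: fin_dim_def)
  moreover obtain Basis where Basis: "Basis \<subseteq> S" "independent Basis" "S \<subseteq> span Basis"
    by (rule maximal_independent_subset) (rule that)
  ultimately have Basis': "span Basis = UNIV" "finite Basis"
    using span_minimal[OF Basis(3) subspace_span] by (auto intro: finite_subset)
  have relB: "B (B (A v)) - scale (jouk (q\<^sup>2)) (B (A (B v))) + A (B (B v)) + scale ((q\<^sup>2 - inverse (q\<^sup>2))\<^sup>2) (A v)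
      = scale ?g (B v) + scale (?k\<^sup>2 * \<alpha>) v" for v
    using askey_wilson_relation[OF A.lin_op_axioms B.lin_op_axioms q k C, of v \<alpha>] \<alpha>[of v]
    by (simp add: aw_cen_def)
  have relA: "A (A (B v)) - scale (jouk (q\<^sup>2)) (A (B (A v))) + B (A (A v)) + scale ((q\<^sup>2 - inverse (q\<^sup>2))\<^sup>2) (B v)
      = scale ?g (A v) + scale (?k\<^sup>2 * \<beta>) v" for v
  proof -
    \<comment> \<open>Exchanging A and B amounts to replacing q by its inverse.\<close>
    have sgn: "(inverse q)\<^sup>2 - inverse (inverse q) ^ 2 = - ?k"
      by simp
    have inv: "inverse (- ?k) = - inverse ?k"
      by (rule inverse_minus_eq)
    have C': "C v = scale \<gamma> v - scale (inverse ((inverse q)\<^sup>2 - inverse (inverse q) ^ 2))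
        (scale (inverse q) (B (A v)) - scale (inverse (inverse q)) (A (B v)))" for v
      unfolding sgn inv C by (simp add: scale_right_diff_distrib)
    have "B v + scale (inverse ((inverse q)\<^sup>2 - inverse (inverse q) ^ 2))
        (scale (inverse q) (A (C v)) - scale (inverse (inverse q)) (C (A v))) = scale \<beta> v"
      unfolding sgn inv \<beta>[symmetric] aw_cen_def by (simp add: scale_right_diff_distrib)
    then have "A (A (B v)) - scale (jouk ((inverse q)\<^sup>2)) (A (B (A v))) + B (A (A v))
        + scale (((inverse q)\<^sup>2 - inverse ((inverse q)\<^sup>2))\<^sup>2) (B v)
      = scale (- (- ?k) * (inverse q - inverse (inverse q)) * \<gamma>) (A v) + scale ((- ?k)\<^sup>2 * \<beta>) v"
      using askey_wilson_relation[OF B.lin_op_axioms A.lin_op_axioms _ _ C', of v \<beta>] q k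
      unfolding sgn by simp
    moreover have "jouk ((inverse q)\<^sup>2) = jouk (q\<^sup>2)"
      using jouk_inverse[of "q\<^sup>2"] by (simp only: power_inverse)
    moreover have "((inverse q)\<^sup>2 - inverse ((inverse q)\<^sup>2))\<^sup>2 = (q\<^sup>2 - inverse (q\<^sup>2))\<^sup>2"
      by (simp add: power_inverse power2_commute)
    moreover have "- (- ?k) * (inverse q - inverse (inverse q)) * \<gamma> = ?g"
      by (simp add: algebra_simps)
    ultimately show ?thesis
      by (simp only: power2_minus)
  qed
  have irred: "W = {0} \<or> W = UNIV" if W: "subspace W" "A ` W \<subseteq> W" "B ` W \<subseteq> W" for W
  proof -
    have "C v \<in> W" if "v \<in> W" for v
      unfolding C using W that by (intro subspace_diff subspace_scale) auto
    then show ?thesis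
      using irr W unfolding aw_irreducible_def by blast
  qed
  interpret aw_pair scale Basis A B q ?g "?k\<^sup>2 * \<beta>" "?k\<^sup>2 * \<alpha>" d'
    using Basis(2) Basis' q d' q_pow relA relB irred dim_lt irr
    by unfold_locales (simp_all add: B.op_add B.op_scale aw_irreducible_def)
  show ?thesis
    using iso_to_Vn[OF C refl] .
qed

end
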